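(* Let $(W,S)$ be a Coxeter system, let $J\subseteq S$, and let $X\subseteq T$ be an order ideal of $(T,\sqsubseteq)$. Then the map $P^J:W\to W$ is order preserving on $(W,\leqslant_{L^X})$: $u\leqslant_{L^X}v$ implies $P^J(u)\leqslant_{L^X}P^J(v)$. In particular, this holds for the $k$-intermediate orders $\leqslant_{L^k}$, for every $k\in\mathbb N$.
   Context: $(W,S)$ is a Coxeter system with length function $\ell$, reflections $T=\{wsw^{-1}:w\in W,\ s\in S\}$ and Bruhat order $\leqslant$. For $X\subseteq T$, $u\leqslant_{L^X}v$ iff $u=v$, or $\ell(u)<\ell(v)$ and there exist $t_1,\dots,t_r\in X$ with $u<t_1u<\dots<t_r\cdots t_1u=v$ in the Bruhat order. For $k\in\mathbb N$, let $T_k=\{t\in T:(\ell(t)-1)/2\leqslant k\}$ and $\leqslant_{L^k}:=\leqslant_{L^{T_k}}$. The Bruhat graph $\Omega_{W,S}$ has vertex set $W$ and an arrow $u\to v$ iff $uv^{-1}\in T$ and $u<v$; $\Omega_{W,S}(Y)$ is its induced subgraph on $Y$. A reflection subgroup $W'$ (a subgroup generated by reflections) has canonical Coxeter generators $S'=\{t\in T:N(t)\cap W'=\{t\}\}$, where $N(v)=\{t\in T:\ell(tv)<\ell(v)\}$; it is dihedral if $|S'|=2$. $t\sqsubseteq' t'$ iff $t=t'$ or there is a dihedral reflection subgroup $W'\ni t,t'$ such that the directed distance from $t$ to $t'$ in $\Omega_{W,S}(W')$ is finite; $\sqsubseteq$ is the transitive closure of $\sqsubseteq'$. For $J\subseteq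 S$, $W_J$ is the subgroup generated by $J$ and $W^J=\{w\in W:\ell(w)<\ell(ws)\ \forall s\in J\}$. Every $w$ factors uniquely as $w=w^Jw_J$ with $w^J\in W^J$, $w_J\in W_J$ and $\ell(w)=\ell(w^J)+\ell(w_J)$. Set $P^J(w):=w^J$. *)

theory Defs
  imports "HOL-Algebra.Algebra"
begin

definition wprod :: "('a, 'b) monoid_scheme \<Rightarrow> 'a list \<Rightarrow> 'a" where
  "wprod G ws = foldr (\<lambda>x y. x \<otimes>\<^bsub>G\<^esub> y) ws \<one>\<^bsub>G\<^esub>"

definition alt_word :: "'a \<Rightarrow> 'a \<Rightarrow> nat \<Rightarrow> 'a list" where
  "alt_word s t n = map (\<lambda>i. if even i then s else t) [0..<n]"

text \<open>One elementary move of the Coxeter presentation: deleting a relator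
  (s t)^m(s,t), where m(s,t) is the (finite) order of st; for s = t this is s s.\<close>
definition cox_move :: "('a, 'b) monoid_scheme \<Rightarrow> 'a set \<Rightarrow> 'a list \<Rightarrow> 'a list \<Rightarrow> bool" where
  "cox_move G S x y \<longleftrightarrow> (\<exists>u v s t. s \<in> S \<and> t \<in> S \<and> group.ord G (s \<otimes>\<^bsub>G\<^esub> t) > 0 \<and>
      x = u @ alt_word s t (2 * group.ord G (s \<otimes>\<^bsub>G\<^esub> t)) @ v \<and> y = u @ v)"

text \<open>(W,S) is a Coxeter system: S is a generating set of involutions of the group W
  and W has the presentation with generators S and relations (st)^m(s,t) = 1,
  i.e. every word in S representing the identity is a consequence of the relators.\<close>
definition coxeter_system :: "('a, 'b) monoid_scheme \<Rightarrow> 'a set \<Rightarrow> bool" where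
  "coxeter_system G S \<longleftrightarrow> group G \<and> S \<subseteq> carrier G \<and> generate G S = carrier G \<and>
     (\<forall>s\<in>S. s \<noteq> \<one>\<^bsub>G\<^esub> \<and> s \<otimes>\<^bsub>G\<^esub> s = \<one>\<^bsub>G\<^esub>) \<and>
     (\<forall>ws \<in> lists S. wprod G ws = \<one>\<^bsub>G\<^esub> \<longrightarrow> equivclp (cox_move G S) ws [])"

definition cox_len :: "('a, 'b) monoid_scheme \<Rightarrow> 'a set \<Rightarrow> 'a \<Rightarrow> nat" where
  "cox_len G S w = (LEAST n. \<exists>ws \<in> lists S. length ws = n \<and> wprod G ws = w)"

definition reflections :: "('a, 'b) monoid_scheme \<Rightarrow> 'a set \<Rightarrow> 'a set" where
  "reflections G S = {w \<otimes>\<^bsub>G\<^esub> s \<otimes>\<^bsub>G\<^esub> inv\<^bsub>G\<^esub> w | w s. w \<in> carrier G \<and> s \<in> S}"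

definition bruhat_step :: "('a, 'b) monoid_scheme \<Rightarrow> 'a set \<Rightarrow> 'a \<Rightarrow> 'a \<Rightarrow> bool" where
  "bruhat_step G S u v \<longleftrightarrow> u \<in> carrier G \<and> v \<in> carrier G \<and>
     (\<exists>t \<in> reflections G S. v = t \<otimes>\<^bsub>G\<^esub> u) \<and> cox_len G S u < cox_len G S v"

definition bruhat_le :: "('a, 'b) monoid_scheme \<Rightarrow> 'a set \<Rightarrow> 'a \<Rightarrow> 'a \<Rightarrow> bool" where
  "bruhat_le G S u v \<longleftrightarrow> u \<in> carrier G \<and> v \<in> carrier G \<and> (bruhat_step G S)\<^sup>*\<^sup>* u v"

definition bruhat_lt :: "('a, 'b) monoid_scheme \<Rightarrow> 'a set \<Rightarrow> 'a \<Rightarrow> 'a \<Rightarrow> bool" where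
  "bruhat_lt G S u v \<longleftrightarrow> bruhat_le G S u v \<and> u \<noteq> v"

definition LX_step :: "('a, 'b) monoid_scheme \<Rightarrow> 'a set \<Rightarrow> 'a set \<Rightarrow> 'a \<Rightarrow> 'a \<Rightarrow> bool" where
  "LX_step G S R x y \<longleftrightarrow> (\<exists>t \<in> R. y = t \<otimes>\<^bsub>G\<^esub> x \<and> bruhat_lt G S x y)"

definition le_LX :: "('a, 'b) monoid_scheme \<Rightarrow> 'a set \<Rightarrow> 'a set \<Rightarrow> 'a \<Rightarrow> 'a \<Rightarrow> bool" where
  "le_LX G S R u v \<longleftrightarrow> u = v \<or> (cox_len G S u < cox_len G S v \<and> (LX_step G S R)\<^sup>+\<^sup>+ u v)"

definition refl_T_k :: "('a, 'b) monoid_scheme \<Rightarrow> 'a set \<Rightarrow> nat \<Rightarrow> 'a set" where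
  "refl_T_k G S k = {t \<in> reflections G S. (real (cox_len G S t) - 1) / 2 \<le> real k}"

definition le_Lk :: "('a, 'b) monoid_scheme \<Rightarrow> 'a set \<Rightarrow> nat \<Rightarrow> 'a \<Rightarrow> 'a \<Rightarrow> bool" where
  "le_Lk G S k = le_LX G S (refl_T_k G S k)"

definition bruhat_arrow :: "('a, 'b) monoid_scheme \<Rightarrow> 'a set \<Rightarrow> 'a \<Rightarrow> 'a \<Rightarrow> bool" where
  "bruhat_arrow G S u v \<longleftrightarrow> u \<otimes>\<^bsub>G\<^esub> inv\<^bsub>G\<^esub> v \<in> reflections G S \<and> bruhat_lt G S u v"

definition bruhat_arrow_on :: "('a, 'b) monoid_scheme \<Rightarrow> 'a set \<Rightarrow> 'a set \<Rightarrow> 'a \<Rightarrow> 'a \<Rightarrow> bool" where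
  "bruhat_arrow_on G S Y u v \<longleftrightarrow> u \<in> Y \<and> v \<in> Y \<and> bruhat_arrow G S u v"

definition left_inversions :: "('a, 'b) monoid_scheme \<Rightarrow> 'a set \<Rightarrow> 'a \<Rightarrow> 'a set" where
  "left_inversions G S v = {t \<in> reflections G S. cox_len G S (t \<otimes>\<^bsub>G\<^esub> v) < cox_len G S v}"

definition reflection_subgroup :: "('a, 'b) monoid_scheme \<Rightarrow> 'a set \<Rightarrow> 'a set \<Rightarrow> bool" where
  "reflection_subgroup G S W' \<longleftrightarrow> (\<exists>R \<subseteq> reflections G S. W' = generate G R)"

definition canonical_gens :: "('a, 'b) monoid_scheme \<Rightarrow> 'a set \<Rightarrow> 'a set \<Rightarrow> 'a set" where
  "canonical_gens G S W' = {t \<in> reflections G S. left_inversions G S t \<inter> W' = {t}}"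

definition dihedral_refl_subgroup :: "('a, 'b) monoid_scheme \<Rightarrow> 'a set \<Rightarrow> 'a set \<Rightarrow> bool" where
  "dihedral_refl_subgroup G S W' \<longleftrightarrow> reflection_subgroup G S W' \<and>
     finite (canonical_gens G S W') \<and> card (canonical_gens G S W') = 2"

definition refl_sq' :: "('a, 'b) monoid_scheme \<Rightarrow> 'a set \<Rightarrow> 'a \<Rightarrow> 'a \<Rightarrow> bool" where
  "refl_sq' G S t t' \<longleftrightarrow> t \<in> reflections G S \<and> t' \<in> reflections G S \<and>
     (t = t' \<or> (\<exists>W'. dihedral_refl_subgroup G S W' \<and> t \<in> W' \<and> t' \<in> W' \<and>
                       (bruhat_arrow_on G S W')\<^sup>*\<^sup>* t t'))"

definition refl_sq :: "('a, 'b) monoid_scheme \<Rightarrow> 'a set \<Rightarrow> 'a \<Rightarrow> 'a \<Rightarrow> bool" where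
  "refl_sq G S = (refl_sq' G S)\<^sup>+\<^sup>+"

definition order_ideal_T :: "('a, 'b) monoid_scheme \<Rightarrow> 'a set \<Rightarrow> 'a set \<Rightarrow> bool" where
  "order_ideal_T G S R \<longleftrightarrow> R \<subseteq> reflections G S \<and>
     (\<forall>t t'. t' \<in> R \<longrightarrow> refl_sq G S t t' \<longrightarrow> t \<in> R)"

definition min_coset_reps :: "('a, 'b) monoid_scheme \<Rightarrow> 'a set \<Rightarrow> 'a set \<Rightarrow> 'a set" where
  "min_coset_reps G S J = {w \<in> carrier G. \<forall>s \<in> J. cox_len G S w < cox_len G S (w \<otimes>\<^bsub>G\<^esub> s)}"

definition proj_J :: "('a, 'b) monoid_scheme \<Rightarrow> 'a set \<Rightarrow> 'a set \<Rightarrow> 'a \<Rightarrow> 'a" where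
  "proj_J G S J w = (THE x. x \<in> min_coset_reps G S J \<and>
     (\<exists>y \<in> generate G J. w = x \<otimes>\<^bsub>G\<^esub> y \<and> cox_len G S w = cox_len G S x + cox_len G S y))"

end

theory Submission
  imports Defs
begin

text \<open>
  The parity with which the gallery of a word crosses each wall is unchanged by the relators; hence
  the left inversion sets form a cocycle: \<open>N(xy)\<close> is the symmetric difference of \<open>N(x)\<close> and
  \<open>x N(y) x\<inverse>\<close>. This yields the exchange property for reflection subgroups \<open>W'\<close> with respect
  to their canonical generators. Moreover, if \<open>N(y)\<close> does not meet \<open>W'\<close>, then \<open>N(hy)\<close> and \<open>N(h)\<close>
  have the same trace on \<open>W'\<close> for all \<open>h \<in> W'\<close>.

  Iterating the maps \<open>w \<mapsto> min(w, ws)\<close> with \<open>s \<in> J\<close> leads from \<open>w\<close> to \<open>P\<^sup>J(w)\<close>, so it suffices to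
  show that these maps are order preserving. For a single step \<open>u < tu\<close> the only nontrivial
  situation is \<open>x < xs < txs < tx\<close>, where a chain from \<open>x\<close> to \<open>txs\<close> with reflections in \<open>X\<close> is
  required. Let \<open>W'\<close> be the dihedral group generated by \<open>t\<close> and \<open>xsx\<inverse>\<close>, and write \<open>x = hy\<close> with
  \<open>h \<in> W'\<close> and \<open>N(y)\<close> disjoint from \<open>W'\<close>. Then \<open>xs = hey\<close> for a canonical generator \<open>e\<close> of \<open>W'\<close>,
  and in \<open>W'\<close> the situation is \<open>h < he < the < th\<close>. Neither \<open>h\<close> nor \<open>the\<close> has \<open>e\<close> as a right
  descent, so both are suffixes of the same alternating word, and left multiplication by the two
  canonical generators leads from \<open>h\<close> to \<open>the\<close>. Since \<open>th\<close> is too long for \<open>t\<close> to be one of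
  these generators, they lie below \<open>t\<close> in the order \<open>\<sqsubseteq>\<close>, and hence they belong to \<open>X\<close>.
\<close>

section \<open>Words in involutions\<close>

lemma alt_word_0 [simp]: "alt_word x y 0 = []"
  by (simp add: alt_word_def)

lemma alt_word_Suc [simp]: "alt_word x y (Suc n) = x # alt_word y x n"
  unfolding alt_word_def by (simp add: upt_conv_Cons map_Suc_upt [symmetric] o_def del: upt_Suc)

lemma length_alt_word [simp]: "length (alt_word x y n) = n"
  by (simp add: alt_word_def)

lemma set_alt_word: "x \<in> A \<Longrightarrow> y \<in> A \<Longrightarrow> set (alt_word x y n) \<subseteq> A"
  by (auto simp: alt_word_def)

lemma take_alt_word: "m \<le> n \<Longrightarrow> take m (alt_word x y n) = alt_word x y m"
  by (simp add: alt_word_def take_map take_upt)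

lemma rev_alt_word_odd: "odd n \<Longrightarrow> rev (alt_word x y n) = alt_word x y n"
  by (rule nth_equalityI) (auto simp: alt_word_def rev_nth)

lemma distinct_adj_eq_alt_word:
  assumes "set ws \<subseteq> {x, y}" "distinct_adj (y # ws)"
  shows "ws = alt_word x y (length ws)"
  using assms
proof (induction ws arbitrary: x y)
  case (Cons z ws)
  then have "z = x" by auto
  moreover have "ws = alt_word y x (length ws)"
    using Cons.prems \<open>z = x\<close> by (intro Cons.IH) auto
  ultimately show ?case by simp
qed simp

lemma wprod_Nil [simp]: "wprod G [] = \<one>\<^bsub>G\<^esub>"
  and wprod_Cons [simp]: "wprod G (x # ws) = x \<otimes>\<^bsub>G\<^esub> wprod G ws"
  by (simp_all add: wprod_def)

context group
begin

lemma inv_mult_cancel_left [simp]: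
  "x \<in> carrier G \<Longrightarrow> y \<in> carrier G \<Longrightarrow> inv x \<otimes> (x \<otimes> y) = y"
  "x \<in> carrier G \<Longrightarrow> y \<in> carrier G \<Longrightarrow> x \<otimes> (inv x \<otimes> y) = y"
  by (simp_all add: m_assoc [symmetric])

lemma conj_eq_iff:
  "x \<in> carrier G \<Longrightarrow> y \<in> carrier G \<Longrightarrow> z \<in> carrier G \<Longrightarrow>
    inv x \<otimes> y \<otimes> x = z \<longleftrightarrow> y = x \<otimes> z \<otimes> inv x"
  by (auto simp: m_assoc)

lemma wprod_closed [simp]: "set ws \<subseteq> carrier G \<Longrightarrow> wprod G ws \<in> carrier G"
  by (induction ws) auto

lemma wprod_append:
  "set us \<subseteq> carrier G \<Longrightarrow> set vs \<subseteq> carrier G \<Longrightarrow>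
    wprod G (us @ vs) = wprod G us \<otimes> wprod G vs"
  by (induction us) (auto simp: m_assoc)

lemma wprod_in_generate: "set ws \<subseteq> A \<Longrightarrow> wprod G ws \<in> generate G A"
  by (induction ws) (auto intro: generate.intros)

lemma mult_pow_shift:
  assumes "x \<in> carrier G" "y \<in> carrier G"
  shows "x \<otimes> (y \<otimes> x) [^] (n::nat) = (x \<otimes> y) [^] n \<otimes> x"
proof (induction n)
  case (Suc n)
  have "x \<otimes> (y \<otimes> x) [^] Suc n = (x \<otimes> (y \<otimes> x) [^] n) \<otimes> (y \<otimes> x)"
    using assms by (simp add: m_assoc)
  then show ?case using assms by (simp add: Suc m_assoc)
qed (use assms in simp)

lemma wprod_alt_word_even:
  assumes "x \<in> carrier G" "y \<in> carrier G"
  shows "wprod G (alt_word x y (2 * n)) = (x \<otimes> y) [^] n"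
proof (induction n)
  case (Suc n)
  have "wprod G (alt_word x y (2 * Suc n)) = (x \<otimes> y) \<otimes> (x \<otimes> y) [^] n"
    using assms by (simp add: Suc m_assoc)
  then show ?case using assms by (metis m_closed nat_pow_Suc2)
qed simp

end

locale involutions = group G for G :: "('a, 'b) monoid_scheme" (structure) +
  fixes A :: "'a set"
  assumes gen_closed [simp]: "a \<in> A \<Longrightarrow> a \<in> carrier G"
    and gen_square [simp]: "a \<in> A \<Longrightarrow> a \<otimes> a = \<one>"
begin

abbreviation len\<^sub>A :: "'a \<Rightarrow> nat" where "len\<^sub>A \<equiv> cox_len G A"

definition reduced :: "'a list \<Rightarrow> bool" where
  "reduced ws \<longleftrightarrow> set ws \<subseteq> A \<and> len\<^sub>A (wprod G ws) = length ws"

lemma gen_inv [simp]: "a \<in> A \<Longrightarrow> inv a = a"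
  by (simp add: inv_equality)

lemma gen_cancel [simp]: "a \<in> A \<Longrightarrow> x \<in> carrier G \<Longrightarrow> a \<otimes> (a \<otimes> x) = x"
  by (simp add: m_assoc [symmetric])

lemma gen_conj_eq_iff:
  "a \<in> A \<Longrightarrow> x \<in> carrier G \<Longrightarrow> y \<in> carrier G \<Longrightarrow> a \<otimes> x \<otimes> a = y \<longleftrightarrow> x = a \<otimes> y \<otimes> a"
  using conj_eq_iff [of a x y] by simp

lemma word_closed [simp]: "set ws \<subseteq> A \<Longrightarrow> set ws \<subseteq> carrier G"
  by auto

lemma generate_closed: "x \<in> generate G A \<Longrightarrow> x \<in> carrier G"
  by (rule generate_in_carrier) auto

lemma generate_subgroup: "subgroup (generate G A) G"
  by (rule generate_is_subgroup) auto

lemma inv_wprod: "set ws \<subseteq> A \<Longrightarrow> inv (wprod G ws) = wprod G (rev ws)"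
  by (induction ws) (simp_all add: wprod_append inv_mult_group)

lemma generate_eq_wprod: "generate G A = wprod G ` {ws. set ws \<subseteq> A}"
proof (intro subset_antisym subsetI)
  fix w assume "w \<in> generate G A"
  then show "w \<in> wprod G ` {ws. set ws \<subseteq> A}"
  proof (induction rule: generate.induct)
    case one
    show ?case by (rule image_eqI [of _ _ "[]"]) auto
  next
    case (incl a)
    then show ?case by (intro image_eqI [of _ _ "[a]"]) auto
  next
    case (inv a)
    then show ?case by (intro image_eqI [of _ _ "[a]"]) auto
  next
    case (eng u v)
    then obtain us vs where "set us \<subseteq> A" "set vs \<subseteq> A" "u = wprod G us" "v = wprod G vs"
      by blast
    then show ?case by (intro image_eqI [of _ _ "us @ vs"]) (auto simp: wprod_append)
  qed
qed (auto intro: wprod_in_generate)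

lemma len_wprod_le: "set ws \<subseteq> A \<Longrightarrow> len\<^sub>A (wprod G ws) \<le> length ws"
  unfolding cox_len_def lists_eq_set by (rule Least_le) blast

lemma ex_reduced:
  assumes "w \<in> generate G A" obtains ws where "reduced ws" "wprod G ws = w"
proof -
  obtain us where "set us \<subseteq> A" "wprod G us = w"
    using assms generate_eq_wprod by auto
  then have "\<exists>ws\<in>lists A. length ws = length us \<and> wprod G ws = w"
    by (intro bexI [of _ us]) auto
  then have "\<exists>ws\<in>lists A. length ws = len\<^sub>A w \<and> wprod G ws = w"
    unfolding cox_len_def by (rule LeastI)
  then obtain ws where "set ws \<subseteq> A" "length ws = len\<^sub>A w" "wprod G ws = w"
    by (auto simp: lists_eq_set)
  then show ?thesis by (intro that) (simp_all add: reduced_def)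
qed

lemma len_one [simp]: "len\<^sub>A \<one> = 0"
  using len_wprod_le [of "[]"] by simp

lemma len_eq_0_iff:
  assumes "w \<in> generate G A" shows "len\<^sub>A w = 0 \<longleftrightarrow> w = \<one>"
proof -
  obtain ws where "reduced ws" "wprod G ws = w" using assms by (rule ex_reduced)
  then show ?thesis by (auto simp: reduced_def)
qed

lemma len_gen_le: "a \<in> A \<Longrightarrow> len\<^sub>A a \<le> 1"
  using len_wprod_le [of "[a]"] by simp

lemma len_mult_le:
  assumes "x \<in> generate G A" "y \<in> generate G A"
  shows "len\<^sub>A (x \<otimes> y) \<le> len\<^sub>A x + len\<^sub>A y"
proof -
  obtain us where "reduced us" "wprod G us = x" using assms(1) by (rule ex_reduced)
  moreover obtain vs where "reduced vs" "wprod G vs = y" using assms(2) by (rule ex_reduced)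
  ultimately show ?thesis
    using len_wprod_le [of "us @ vs"] by (auto simp: reduced_def wprod_append)
qed

lemma len_inv [simp]:
  assumes "x \<in> generate G A" shows "len\<^sub>A (inv x) = len\<^sub>A x"
proof -
  have "len\<^sub>A (inv z) \<le> len\<^sub>A z" if z: "z \<in> generate G A" for z
  proof -
    obtain ws where "reduced ws" "wprod G ws = z" using z by (rule ex_reduced)
    then show ?thesis
      using len_wprod_le [of "rev ws"] inv_wprod [of ws] by (auto simp: reduced_def)
  qed
  from this [of x] this [of "inv x"] show ?thesis
    using assms generate_subgroup by (simp add: generate_closed subgroup.m_inv_closed)
qed

lemma reduced_append:
  assumes "reduced (us @ vs)" shows "reduced us" "reduced vs"
proof -
  have ws: "set us \<subseteq> A" "set vs \<subseteq> A" using assms by (auto simp: reduced_def)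
  then have "length us + length vs \<le> len\<^sub>A (wprod G us) + len\<^sub>A (wprod G vs)"
    using assms len_mult_le [of "wprod G us" "wprod G vs"]
    by (simp add: reduced_def wprod_append wprod_in_generate)
  then show "reduced us" "reduced vs"
    using ws len_wprod_le [of us] len_wprod_le [of vs] by (auto simp: reduced_def)
qed

lemma reduced_distinct_adj: "reduced ws \<Longrightarrow> distinct_adj ws"
proof (induction ws rule: induct_list012)
  case (3 a b ws)
  have "a \<noteq> b"
  proof
    assume "a = b"
    then have "len\<^sub>A (wprod G ws) = length (a # b # ws)" "set ws \<subseteq> A"
      using "3.prems" by (auto simp: reduced_def)
    then show False using len_wprod_le [of ws] by simp
  qed
  moreover have "reduced (b # ws)" using "3.prems" reduced_append(2) [of "[a]"] by simp
  ultimately show ?case using "3.IH"(2) by simp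
qed simp_all

lemma reduced_rev: "reduced ws \<Longrightarrow> reduced (rev ws)"
  using len_inv [of "wprod G ws"] by (simp add: reduced_def inv_wprod wprod_in_generate)

lemma ex_left_descent:
  assumes "w \<in> generate G A" "w \<noteq> \<one>"
  obtains a v where "a \<in> A" "v \<in> generate G A" "w = a \<otimes> v" "len\<^sub>A v < len\<^sub>A w"
proof -
  obtain ws where ws: "reduced ws" "wprod G ws = w" using assms(1) by (rule ex_reduced)
  with assms(2) obtain a us where us: "ws = a # us" by (cases ws) auto
  then show ?thesis
    using that [of a "wprod G us"] ws len_wprod_le [of us]
    by (auto simp: reduced_def wprod_in_generate)
qed

lemma generate_commute:
  assumes x: "x \<in> carrier G" "\<And>a. a \<in> A \<Longrightarrow> a \<otimes> x = x \<otimes> a" and "w \<in> generate G A"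
  shows "w \<otimes> x = x \<otimes> w"
proof -
  have "wprod G ws \<otimes> x = x \<otimes> wprod G ws" if "set ws \<subseteq> A" for ws
    using that
  proof (induction ws)
    case (Cons a ws)
    then have a: "a \<in> A" "set ws \<subseteq> A" by auto
    then have "wprod G (a # ws) \<otimes> x = (a \<otimes> x) \<otimes> wprod G ws"
      using Cons.IH x(1) by (simp add: m_assoc)
    then show ?case using a x by (simp add: m_assoc)
  qed (use x in simp)
  then show ?thesis using assms(3) generate_eq_wprod by auto
qed

end

section \<open>Crossing parity and the exchange property\<close>

text \<open>The gallery of the word \<open>s\<^sub>1 \<dots> s\<^sub>n\<close> crosses the walls of the reflections
  \<open>s\<^sub>1 \<dots> s\<^sub>i \<dots> s\<^sub>1\<close>; this is the parity of the number of times that the wall of \<open>t\<close> occurs.\<close>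

primrec crossing_parity :: "('a, 'b) monoid_scheme \<Rightarrow> 'a list \<Rightarrow> 'a \<Rightarrow> bool" where
  "crossing_parity G [] t = False"
| "crossing_parity G (s # ws) t = ((t = s) \<noteq> crossing_parity G ws (s \<otimes>\<^bsub>G\<^esub> t \<otimes>\<^bsub>G\<^esub> s))"

context involutions
begin

lemma crossing_parity_append:
  assumes "set us \<subseteq> A" "t \<in> carrier G"
  shows "crossing_parity G (us @ vs) t \<longleftrightarrow>
    (crossing_parity G us t \<noteq> crossing_parity G vs (inv (wprod G us) \<otimes> t \<otimes> wprod G us))"
  using assms
proof (induction us arbitrary: t)
  case (Cons a us)
  then have "a \<otimes> t \<otimes> a \<in> carrier G" by simp
  with Cons.IH [of "a \<otimes> t \<otimes> a"] Cons.prems show ?case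
    by (simp add: inv_mult_group m_assoc) blast
qed simp

lemma crossing_parity_deletion:
  assumes "set ws \<subseteq> A" "t \<in> carrier G" "crossing_parity G ws t"
  shows "\<exists>us a vs. ws = us @ a # vs \<and> t \<otimes> wprod G ws = wprod G (us @ vs)"
  using assms
proof (induction ws arbitrary: t)
  case (Cons a ws)
  then have a: "a \<in> A" "set ws \<subseteq> A" by auto
  show ?case
  proof (cases "t = a")
    case True
    then show ?thesis using a by (intro exI [of _ "[]"]) simp
  next
    case False
    then obtain us b vs where "ws = us @ b # vs" "a \<otimes> t \<otimes> a \<otimes> wprod G ws = wprod G (us @ vs)"
      using Cons.IH [of "a \<otimes> t \<otimes> a"] Cons.prems a by auto
    moreover from this have "t \<otimes> wprod G (a # ws) = wprod G ((a # us) @ vs)"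
      using a Cons.prems(2) by (simp add: m_assoc flip: \<open>_ = wprod G (us @ vs)\<close>)
    ultimately show ?thesis by (metis append_Cons)
  qed
qed simp

lemma crossing_parity_palindrome:
  assumes "set us \<subseteq> A" "a \<in> A"
  shows "crossing_parity G (us @ a # rev us) (wprod G (us @ a # rev us))"
  using assms(1)
proof (induction us)
  case (Cons b us)
  define ws where "ws = us @ a # rev us"
  have ws: "set ws \<subseteq> A" "b \<in> A" using Cons.prems assms by (auto simp: ws_def)
  define t where "t = wprod G ws"
  have t: "t \<in> carrier G" using ws by (simp add: t_def)
  have product: "wprod G (b # ws @ [b]) = b \<otimes> t \<otimes> b"
    using ws by (simp add: wprod_append m_assoc t_def)
  have conj: "b \<otimes> (b \<otimes> t \<otimes> b) \<otimes> b = t" "b \<otimes> t \<otimes> b = b \<longleftrightarrow> t = b"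
    using t ws gen_conj_eq_iff [of b t b] by (simp_all add: m_assoc)
  have "crossing_parity G (ws @ [b]) t \<longleftrightarrow> crossing_parity G ws t \<noteq> (t = b)"
    using crossing_parity_append [OF ws(1) t, of "[b]"] t by (simp flip: t_def)
  moreover have "crossing_parity G ws t" using Cons by (simp add: t_def ws_def)
  ultimately have "crossing_parity G (b # ws @ [b]) (wprod G (b # ws @ [b]))"
    unfolding product by (simp add: conj)
  then show ?case by (simp add: ws_def)
qed (use assms in simp)

lemma crossing_parity_alt_word:
  assumes "a \<in> A" "b \<in> A" "t \<in> carrier G"
  shows "crossing_parity G (alt_word a b n) t \<longleftrightarrow>
    odd (\<Sum>i<n. of_bool ((a \<otimes> b) [^] i \<otimes> a = t) :: nat)"
  using assms
proof (induction n arbitrary: a b t)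
  case (Suc n)
  have conj: "(b \<otimes> a) [^] i \<otimes> b = a \<otimes> t \<otimes> a \<longleftrightarrow> (a \<otimes> b) [^] Suc i \<otimes> a = t" for i :: nat
  proof -
    have "(a \<otimes> b) [^] Suc i \<otimes> a = a \<otimes> ((b \<otimes> a) [^] i \<otimes> b) \<otimes> a"
      using Suc.prems mult_pow_shift [of a b i, symmetric] by (simp add: m_assoc [symmetric])
    then show ?thesis using Suc.prems by (simp add: gen_conj_eq_iff)
  qed
  have "a \<otimes> t \<otimes> a \<in> carrier G" using Suc.prems by simp
  from Suc.IH [OF Suc.prems(2,1) this] show ?case
    using Suc.prems unfolding sum.lessThan_Suc_shift conj by (auto simp del: nat_pow_Suc)
qed simp

lemma crossing_parity_relator:
  assumes "a \<in> A" "b \<in> A" "t \<in> carrier G"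
  shows "\<not> crossing_parity G (alt_word a b (2 * ord (a \<otimes> b))) t"
proof -
  define m where "m = ord (a \<otimes> b)"
  define f where "f i = (of_bool ((a \<otimes> b) [^] i \<otimes> a = t) :: nat)" for i :: nat
  have "(a \<otimes> b) [^] (i + m) = (a \<otimes> b) [^] i" for i
    using assms pow_ord_eq_1 [of "a \<otimes> b"] by (simp add: m_def nat_pow_mult [symmetric])
  then have periodic: "f (i + m) = f i" for i
    by (simp add: f_def)
  have "sum f {..<2 * m} = sum f {..<m} + sum f {m..<m + m}"
    by (simp add: mult_2 lessThan_atLeast0 sum.atLeastLessThan_concat)
  also have "sum f {m..<m + m} = sum f {..<m}"
    using sum.shift_bounds_nat_ivl [of f 0 m m] by (simp add: periodic lessThan_atLeast0)
  finally show ?thesis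
    using crossing_parity_alt_word [OF assms, of "2 * m"] by (simp add: m_def f_def)
qed

text \<open>If the crossing parity of \<open>c\<close> depends only on the product of a word, then it says
  whether \<open>c\<close> shortens that product: a crossing yields a letter that can be deleted, and passing
  from \<open>w\<close> to \<open>cw\<close> flips the parity.\<close>

lemma crossing_parity_iff_len_less:
  assumes c: "c \<in> generate G A" "c \<otimes> c = \<one>"
    and crosses: "\<And>ws. set ws \<subseteq> A \<Longrightarrow> crosses (wprod G ws) \<longleftrightarrow> crossing_parity G ws c"
      "crosses c"
    and w: "w \<in> generate G A"
  shows "crosses w \<longleftrightarrow> len\<^sub>A (c \<otimes> w) < len\<^sub>A w"
proof -
  have closed: "c \<in> carrier G" "w \<in> carrier G" using c(1) w by (simp_all add: generate_closed)
  have shorter: "len\<^sub>A (c \<otimes> z) < len\<^sub>A z" if z: "z \<in> generate G A" "crosses z" for z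
  proof -
    obtain ws where ws: "reduced ws" "wprod G ws = z" using z(1) by (rule ex_reduced)
    then obtain us a vs where "ws = us @ a # vs" "c \<otimes> z = wprod G (us @ vs)"
      using crossing_parity_deletion [of ws c] crosses(1) z(2) closed(1)
      by (metis reduced_def)
    then show ?thesis using ws len_wprod_le [of "us @ vs"] by (simp add: reduced_def)
  qed
  have "crosses (c \<otimes> w) \<longleftrightarrow> \<not> crosses w"
  proof -
    obtain cs ws where words: "set cs \<subseteq> A" "wprod G cs = c" "set ws \<subseteq> A" "wprod G ws = w"
      using c(1) w by (metis ex_reduced reduced_def)
    then have "wprod G (cs @ ws) = c \<otimes> w" "crossing_parity G cs c" "inv c \<otimes> c \<otimes> c = c"
      using crosses c closed by (auto simp: wprod_append)
    then show ?thesis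
      using words crosses(1) [of "cs @ ws"] crosses(1) [of ws] crossing_parity_append [of cs c ws]
        closed by simp
  qed
  moreover have "c \<otimes> (c \<otimes> w) = w" using c closed by (simp flip: m_assoc)
  moreover have "c \<otimes> w \<in> generate G A" using c w by (simp add: generate.eng)
  ultimately show ?thesis using shorter [of w] shorter [of "c \<otimes> w"] w by auto
qed

end

section \<open>The inversion cocycle of a Coxeter system\<close>

locale coxeter = group G for G :: "('a, 'b) monoid_scheme" (structure) +
  fixes S :: "'a set"
  assumes coxeter_system: "coxeter_system G S"

sublocale coxeter \<subseteq> S: involutions G S
  using coxeter_system by unfold_locales (auto simp: coxeter_system_def)

context coxeter
begin

abbreviation len :: "'a \<Rightarrow> nat" where "len \<equiv> cox_len G S"
abbreviation T :: "'a set" where "T \<equiv> reflections G S"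
abbreviation N :: "'a \<Rightarrow> 'a set" where "N \<equiv> left_inversions G S"

lemma generate_S [simp]: "generate G S = carrier G"
  and one_notin_S: "\<one> \<notin> S"
  using coxeter_system by (auto simp: coxeter_system_def)

lemma cox_move_crossing_parity:
  assumes "cox_move G S us vs"
  shows "set us \<subseteq> S \<longleftrightarrow> set vs \<subseteq> S"
    and "set us \<subseteq> S \<Longrightarrow> t \<in> carrier G \<Longrightarrow> crossing_parity G us t \<longleftrightarrow> crossing_parity G vs t"
proof -
  obtain xs ys r s where move: "r \<in> S" "s \<in> S"
      "us = xs @ alt_word r s (2 * ord (r \<otimes> s)) @ ys" "vs = xs @ ys"
    using assms unfolding cox_move_def by blast
  then have relator: "set (alt_word r s (2 * ord (r \<otimes> s))) \<subseteq> S"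
    by (simp add: set_alt_word)
  then show "set us \<subseteq> S \<longleftrightarrow> set vs \<subseteq> S" using move by auto
  have "crossing_parity G (alt_word r s (2 * ord (r \<otimes> s)) @ ys) z \<longleftrightarrow> crossing_parity G ys z"
    if "z \<in> carrier G" for z
    using that move S.crossing_parity_append [OF relator, of z ys]
    by (simp add: S.crossing_parity_relator wprod_alt_word_even pow_ord_eq_1)
  then show "crossing_parity G us t \<longleftrightarrow> crossing_parity G vs t"
    if "set us \<subseteq> S" "t \<in> carrier G"
    using that move by (simp add: S.crossing_parity_append)
qed

lemma crossing_parity_trivial_word:
  assumes "set ws \<subseteq> S" "wprod G ws = \<one>" "t \<in> carrier G"
  shows "\<not> crossing_parity G ws t"
proof -
  have "equivclp (cox_move G S) ws []"
    using coxeter_system assms by (auto simp: coxeter_system_def)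
  then have "set ws \<subseteq> S \<and> (crossing_parity G ws t \<longleftrightarrow> crossing_parity G [] t)"
    unfolding equivclp_def
  proof (induction rule: converse_rtranclp_induct)
    case (step us vs)
    from step.hyps(1) consider "cox_move G S us vs" | "cox_move G S vs us"
      by (auto simp: symclp_def)
    then show ?case
      using step.IH assms(3) by cases (auto dest: cox_move_crossing_parity)
  qed simp
  then show ?thesis by simp
qed

lemma crossing_parity_cong:
  assumes "set us \<subseteq> S" "set vs \<subseteq> S" "wprod G us = wprod G vs" "t \<in> carrier G"
  shows "crossing_parity G us t \<longleftrightarrow> crossing_parity G vs t"
proof -
  have "\<not> crossing_parity G (ws @ rev vs) t" if "set ws \<subseteq> S" "wprod G ws = wprod G vs" for ws
    using that assms
    by (intro crossing_parity_trivial_word) (simp_all add: wprod_append flip: S.inv_wprod)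
  from this [of us] this [of vs] show ?thesis
    using assms by (auto simp: S.crossing_parity_append)
qed

lemma reflectionE:
  assumes "t \<in> T" obtains p s where "p \<in> carrier G" "s \<in> S" "t = p \<otimes> s \<otimes> inv p"
  using assms unfolding reflections_def by blast

lemma reflection_eq_palindrome:
  assumes "t \<in> T"
  obtains us s where "set us \<subseteq> S" "s \<in> S" "t = wprod G (us @ s # rev us)"
proof -
  obtain p s where t: "p \<in> carrier G" "s \<in> S" "t = p \<otimes> s \<otimes> inv p"
    using assms by (rule reflectionE)
  moreover obtain us where "set us \<subseteq> S" "wprod G us = p"
    using t(1) S.generate_eq_wprod by auto
  ultimately show ?thesis
    by (intro that [of us s]) (auto simp: wprod_append m_assoc simp flip: S.inv_wprod)
qed

lemma S_subset_T: "S \<subseteq> T"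
proof
  fix s assume "s \<in> S"
  then show "s \<in> T"
    unfolding reflections_def by (intro CollectI exI [of _ \<one>] exI [of _ s]) simp
qed

lemma one_notin_T: "\<one> \<notin> T"
proof
  assume "\<one> \<in> T"
  then obtain p s where p: "p \<in> carrier G" "s \<in> S" "\<one> = p \<otimes> s \<otimes> inv p" by (rule reflectionE)
  then have "s = inv p \<otimes> (p \<otimes> s \<otimes> inv p) \<otimes> p" by (simp add: m_assoc)
  also have "\<dots> = \<one>" using p(1) by (simp flip: p(3))
  finally show False using p(2) one_notin_S by simp
qed

lemma T_conj:
  assumes "t \<in> T" "x \<in> carrier G" shows "x \<otimes> t \<otimes> inv x \<in> T"
proof -
  obtain p s where "p \<in> carrier G" "s \<in> S" "t = p \<otimes> s \<otimes> inv p"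
    using assms(1) by (rule reflectionE)
  then show ?thesis using assms(2) unfolding reflections_def
    by (intro CollectI exI [of _ "x \<otimes> p"] exI [of _ s]) (simp add: inv_mult_group m_assoc)
qed

lemma T_conj_inv: "t \<in> T \<Longrightarrow> x \<in> carrier G \<Longrightarrow> inv x \<otimes> t \<otimes> x \<in> T"
  using T_conj [of t "inv x"] by simp

end

sublocale coxeter \<subseteq> T: involutions G T
proof
  fix t assume "t \<in> T"
  then obtain p s where "p \<in> carrier G" "s \<in> S" "t = p \<otimes> s \<otimes> inv p" by (rule reflectionE)
  then show "t \<in> carrier G" "t \<otimes> t = \<one>" by (simp_all add: m_assoc)
qed

context coxeter
begin

lemma crossing_parity_iff_left_inversion:
  assumes "set ws \<subseteq> S" "t \<in> T"
  shows "crossing_parity G ws t \<longleftrightarrow> t \<in> N (wprod G ws)"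
proof -
  define crosses where
    "crosses w \<longleftrightarrow> (\<exists>us. set us \<subseteq> S \<and> wprod G us = w \<and> crossing_parity G us t)" for w
  have crosses: "crosses (wprod G us) \<longleftrightarrow> crossing_parity G us t" if "set us \<subseteq> S" for us
    using that assms(2) by (metis T.gen_closed crossing_parity_cong crosses_def)
  obtain us s where t: "set us \<subseteq> S" "s \<in> S" "t = wprod G (us @ s # rev us)"
    using assms(2) by (rule reflection_eq_palindrome)
  then have "crosses t"
    using crosses [of "us @ s # rev us"] S.crossing_parity_palindrome [of us s] by simp
  then have "crosses (wprod G ws) \<longleftrightarrow> len (t \<otimes> wprod G ws) < len (wprod G ws)"
    using assms crosses by (intro S.crossing_parity_iff_len_less) simp_all
  then show ?thesis using assms crosses by (simp add: left_inversions_def)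
qed

lemma left_inversions_subset: "N x \<subseteq> T"
  by (auto simp: left_inversions_def)

lemma left_inversions_one [simp]: "N \<one> = {}"
  by (simp add: left_inversions_def)

lemma reflection_in_left_inversions: "t \<in> T \<Longrightarrow> t \<in> N t"
  using one_notin_T S.len_eq_0_iff [of t] by (auto simp: left_inversions_def)

lemma left_inversions_mult:
  assumes "x \<in> carrier G" "y \<in> carrier G" "t \<in> T"
  shows "t \<in> N (x \<otimes> y) \<longleftrightarrow> (t \<in> N x) \<noteq> (inv x \<otimes> t \<otimes> x \<in> N y)"
proof -
  obtain us vs where words: "set us \<subseteq> S" "wprod G us = x" "set vs \<subseteq> S" "wprod G vs = y"
    using assms(1,2) S.generate_eq_wprod by auto
  then show ?thesis
    using crossing_parity_iff_left_inversion [of "us @ vs" t]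
      crossing_parity_iff_left_inversion [of us t]
      crossing_parity_iff_left_inversion [of vs "inv x \<otimes> t \<otimes> x"]
      S.crossing_parity_append [of us t vs] assms
    by (simp add: wprod_append T_conj_inv)
qed

lemma left_inversions_mult_self:
  "t \<in> T \<Longrightarrow> x \<in> carrier G \<Longrightarrow> t \<in> N (t \<otimes> x) \<longleftrightarrow> t \<notin> N x"
  using left_inversions_mult [of t x t] by (simp add: reflection_in_left_inversions)

lemma not_left_inversion_iff:
  "t \<in> T \<Longrightarrow> x \<in> carrier G \<Longrightarrow> t \<notin> N x \<longleftrightarrow> len x < len (t \<otimes> x)"
  using left_inversions_mult_self [of t x] by (simp add: left_inversions_def)

lemma left_inversions_S: "s \<in> S \<Longrightarrow> N s = {s}"
  using crossing_parity_iff_left_inversion [of "[s]"] left_inversions_subset [of s] S_subset_T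
  by auto

lemma len_S_mult:
  assumes "s \<in> S" "x \<in> carrier G"
  shows "len (s \<otimes> x) = len x + 1 \<or> len x = len (s \<otimes> x) + 1"
proof -
  have upper: "len (s \<otimes> z) \<le> len z + 1" if "z \<in> carrier G" for z
    using S.len_mult_le [of s z] S.len_gen_le [of s] that assms by simp
  have "len (s \<otimes> x) \<noteq> len x"
    using not_left_inversion_iff [of s x] assms S_subset_T by (auto simp: left_inversions_def)
  moreover have "len x \<le> len (s \<otimes> x) + 1"
    using upper [of "s \<otimes> x"] assms by simp
  ultimately show ?thesis using upper [OF assms(2)] by linarith
qed

lemma len_mult_S:
  assumes "x \<in> carrier G" "s \<in> S"
  shows "len (x \<otimes> s) = len x + 1 \<or> len x = len (x \<otimes> s) + 1"
  using len_S_mult [of s "inv x"] S.len_inv [of x] S.len_inv [of "x \<otimes> s"] assms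
  by (simp add: inv_mult_group)

lemma left_inversions_mult_S:
  assumes "x \<in> carrier G" "s \<in> S" "len x < len (x \<otimes> s)"
  shows "N (x \<otimes> s) = insert (x \<otimes> s \<otimes> inv x) (N x)"
proof -
  let ?p = "x \<otimes> s \<otimes> inv x"
  have p: "?p \<in> T" "?p \<otimes> x = x \<otimes> s" using assms T_conj S_subset_T by (auto simp: m_assoc)
  then have "?p \<notin> N x" using assms by (simp add: not_left_inversion_iff)
  moreover have "t \<in> N (x \<otimes> s) \<longleftrightarrow> (t \<in> N x) \<noteq> (t = ?p)" if "t \<in> T" for t
    using assms that by (simp add: left_inversions_mult left_inversions_S conj_eq_iff)
  ultimately show ?thesis using p(1) left_inversions_subset by blast
qed

lemma ex_right_descent:
  assumes "x \<in> carrier G" "x \<noteq> \<one>"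
  obtains s where "s \<in> S" "len (x \<otimes> s) < len x"
proof -
  obtain ws where ws: "S.reduced ws" "wprod G ws = x"
    using assms(1) S.ex_reduced by auto
  with assms obtain us s where us: "ws = us @ [s]" by (cases ws rule: rev_cases) auto
  then have words: "set us \<subseteq> S" "s \<in> S" using ws by (auto simp: S.reduced_def)
  then have "x \<otimes> s = wprod G us" using ws us by (auto simp: wprod_append m_assoc)
  then have "len (x \<otimes> s) < len x"
    using ws us words S.len_wprod_le [of us] by (simp add: S.reduced_def)
  then show ?thesis using that words by blast
qed

lemma even_len_S_word: "set ws \<subseteq> S \<Longrightarrow> even (len (wprod G ws)) \<longleftrightarrow> even (length ws)"
proof (induction ws)
  case (Cons s ws)
  then show ?case using len_S_mult [of s "wprod G ws"] by auto
qed simp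

lemma even_len_T_word: "set ws \<subseteq> T \<Longrightarrow> even (len (wprod G ws)) \<longleftrightarrow> even (length ws)"
proof (induction ws)
  case (Cons t ws)
  then have "t \<in> T" "wprod G ws \<in> carrier G" by auto
  obtain us s where t: "set us \<subseteq> S" "s \<in> S" "t = wprod G (us @ s # rev us)"
    using \<open>t \<in> T\<close> by (rule reflection_eq_palindrome)
  obtain vs where vs: "set vs \<subseteq> S" "wprod G vs = wprod G ws"
    using \<open>wprod G ws \<in> _\<close> S.generate_eq_wprod by auto
  have "wprod G (t # ws) = wprod G ((us @ s # rev us) @ vs)"
    using t vs \<open>wprod G ws \<in> _\<close> by (simp add: wprod_append m_assoc)
  then show ?case
    using Cons even_len_S_word [of "(us @ s # rev us) @ vs"] even_len_S_word [of vs] t vs by auto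
qed simp

end

section \<open>Canonical generators of reflection subgroups\<close>

context coxeter
begin

lemma T_subset_involutions: "R \<subseteq> T \<Longrightarrow> involutions G R"
  by unfold_locales auto

lemma generate_T_subgroup: "R \<subseteq> T \<Longrightarrow> subgroup (generate G R) G"
  by (rule involutions.generate_subgroup [OF T_subset_involutions])

lemma canonical_gens_subset_T: "canonical_gens G S H \<subseteq> T"
  and canonical_gens_subset: "canonical_gens G S H \<subseteq> H"
  by (auto simp: canonical_gens_def)

lemma generate_canonical_gens_subset:
  "subgroup H G \<Longrightarrow> generate G (canonical_gens G S H) \<subseteq> H"
  by (rule generate_subgroup_incl [OF canonical_gens_subset])

lemma canonical_gens_Int_subset:
  "K \<subseteq> H \<Longrightarrow> canonical_gens G S H \<inter> K \<subseteq> canonical_gens G S K"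
  by (auto simp: canonical_gens_def)

lemma left_inversions_coset:
  assumes "subgroup H G" "h \<in> H" "y \<in> carrier G" "N y \<inter> H = {}"
  shows "N (h \<otimes> y) \<inter> H = N h \<inter> H"
proof -
  have "t \<in> N (h \<otimes> y) \<longleftrightarrow> t \<in> N h" if "t \<in> T" "t \<in> H" for t
  proof -
    have "h \<in> carrier G" "inv h \<otimes> t \<otimes> h \<in> H"
      using assms(1,2) that
      by (simp_all add: subgroup.mem_carrier subgroup.m_closed subgroup.m_inv_closed)
    then show ?thesis using left_inversions_mult [of h y t] assms(3,4) that by blast
  qed
  then show ?thesis using left_inversions_subset by blast
qed

lemma conj_S_canonical:
  assumes "subgroup H G" "y \<in> carrier G" "N y \<inter> H = {}" "s \<in> S" and p: "y \<otimes> s \<otimes> inv y \<in> H"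
  shows "y \<otimes> s \<otimes> inv y \<in> canonical_gens G S H"
proof -
  let ?p = "y \<otimes> s \<otimes> inv y"
  have "?p \<in> T" using assms T_conj S_subset_T by blast
  have "?p \<otimes> y = y \<otimes> s" using assms by (simp add: m_assoc)
  then have "N ?p \<inter> H = N (y \<otimes> s) \<inter> H"
    using left_inversions_coset [OF assms(1) p assms(2,3)] by simp
  moreover have "t \<in> N (y \<otimes> s) \<longleftrightarrow> t = ?p" if t: "t \<in> T" "t \<in> H" for t
  proof -
    have "t \<notin> N y" using t assms(3) by blast
    then show ?thesis
      using t(1) assms(2,4) by (simp add: left_inversions_mult left_inversions_S conj_eq_iff)
  qed
  ultimately have "N ?p \<inter> H = {?p}" using \<open>?p \<in> T\<close> p left_inversions_subset by blast
  then show ?thesis using \<open>?p \<in> T\<close> by (simp add: canonical_gens_def)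
qed

text \<open>Along a gallery from \<open>1\<close> to \<open>x\<close> the first wall of a reflection in \<open>H\<close> is that of a canonical
  generator.\<close>

lemma ex_canonical_left_inversion:
  assumes "subgroup H G" "x \<in> carrier G" "N x \<inter> H \<noteq> {}"
  shows "N x \<inter> canonical_gens G S H \<noteq> {}"
  using assms(2,3)
proof (induction "len x" arbitrary: x rule: less_induct)
  case less
  from less.prems(2) have "x \<noteq> \<one>" by auto
  with less.prems(1) obtain s where s: "s \<in> S" "len (x \<otimes> s) < len x" by (rule ex_right_descent)
  then obtain v where v: "v \<in> carrier G" "v \<otimes> s = x" "len v < len x"
    using that [of "x \<otimes> s"] less.prems(1) by (simp add: m_assoc)
  then have Nx: "N x = insert (v \<otimes> s \<otimes> inv v) (N v)"
    using left_inversions_mult_S [of v s] s(1) by simp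
  show ?case
  proof (cases "N v \<inter> H = {}")
    case True
    then have "v \<otimes> s \<otimes> inv v \<in> H" using less.prems(2) unfolding Nx by auto
    then have "v \<otimes> s \<otimes> inv v \<in> canonical_gens G S H"
      by (rule conj_S_canonical [OF assms(1) v(1) True s(1)])
    then show ?thesis using Nx by blast
  next
    case False
    then have "N v \<inter> canonical_gens G S H \<noteq> {}" by (rule less.hyps [OF v(3,1)])
    then show ?thesis using Nx by blast
  qed
qed

lemma ex_coset_rep:
  assumes "subgroup H G" "x \<in> carrier G"
  obtains h y where "h \<in> generate G (canonical_gens G S H)" "y \<in> carrier G"
    "x = h \<otimes> y" "N y \<inter> H = {}"
proof -
  let ?C = "canonical_gens G S H"
  have C: "generate G ?C \<subseteq> carrier G"
    using generate_T_subgroup [OF canonical_gens_subset_T] by (rule subgroup.subset)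
  define in_coset where
    "in_coset y \<longleftrightarrow> y \<in> carrier G \<and> (\<exists>h\<in>generate G ?C. x = h \<otimes> y)" for y
  have "in_coset x" using assms(2) by (auto simp: in_coset_def intro!: bexI [of _ \<one>] generate.one)
  then obtain y where y: "in_coset y" "\<And>z. in_coset z \<Longrightarrow> len y \<le> len z"
    using ex_has_least_nat [of in_coset x len] by blast
  then obtain h where h: "h \<in> generate G ?C" "x = h \<otimes> y" "y \<in> carrier G"
    by (auto simp: in_coset_def)
  have "N y \<inter> H = {}"
  proof (rule ccontr)
    assume "N y \<inter> H \<noteq> {}"
    then obtain c where c: "c \<in> N y" "c \<in> ?C"
      using ex_canonical_left_inversion [OF assms(1) h(3)] by blast
    then have "c \<in> T" using canonical_gens_subset_T by blast
    then have "x = (h \<otimes> c) \<otimes> (c \<otimes> y)" using h C by (auto simp: m_assoc)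
    moreover have "h \<otimes> c \<in> generate G ?C" using h c by (auto intro: generate.intros)
    ultimately have "in_coset (c \<otimes> y)"
      using h \<open>c \<in> T\<close> by (auto simp: in_coset_def)
    then show False using y(2) c(1) by (fastforce simp: left_inversions_def)
  qed
  then show ?thesis using that h by blast
qed

lemma reflection_conj_canonical:
  assumes "subgroup H G" "t \<in> T" "t \<in> H"
  obtains h a where "h \<in> generate G (canonical_gens G S H)" "a \<in> canonical_gens G S H"
    "t = h \<otimes> a \<otimes> inv h"
proof -
  let ?C = "canonical_gens G S H"
  obtain p s where p: "p \<in> carrier G" "s \<in> S" "t = p \<otimes> s \<otimes> inv p"
    using assms(2) by (rule reflectionE)
  obtain h y where hy: "h \<in> generate G ?C" "y \<in> carrier G" "p = h \<otimes> y" "N y \<inter> H = {}"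
    using assms(1) p(1) by (rule ex_coset_rep)
  then have h: "h \<in> H" "h \<in> carrier G"
    using generate_canonical_gens_subset subgroup.subset assms(1) by blast+
  have t: "t = h \<otimes> (y \<otimes> s \<otimes> inv y) \<otimes> inv h"
    using p hy h by (simp add: inv_mult_group m_assoc)
  then have "y \<otimes> s \<otimes> inv y = inv h \<otimes> t \<otimes> h"
    using hy(2) h(2) p(2) by (simp add: m_assoc)
  then have "y \<otimes> s \<otimes> inv y \<in> H"
    using h(1) assms by (simp add: subgroup.m_closed subgroup.m_inv_closed)
  then show ?thesis
    using that [OF hy(1) conj_S_canonical [OF assms(1) hy(2,4) p(2)] t] by blast
qed

lemma generate_canonical_gens:
  assumes "R \<subseteq> T"
  shows "generate G (canonical_gens G S (generate G R)) = generate G R"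
proof (rule subset_antisym)
  let ?C = "canonical_gens G S (generate G R)"
  have subgroups: "subgroup (generate G R) G" "subgroup (generate G ?C) G"
    using assms canonical_gens_subset_T by (simp_all add: generate_T_subgroup)
  show "generate G ?C \<subseteq> generate G R"
    using subgroups(1) by (rule generate_canonical_gens_subset)
  have "t \<in> generate G ?C" if "t \<in> R" for t
  proof -
    have "t \<in> T" "t \<in> generate G R" using that assms by (auto intro: generate.incl)
    then obtain h a where "h \<in> generate G ?C" "a \<in> ?C" "t = h \<otimes> a \<otimes> inv h"
      using reflection_conj_canonical [OF subgroups(1)] by blast
    then show ?thesis
      using subgroups(2) by (simp add: generate.incl subgroup.m_closed subgroup.m_inv_closed)
  qed
  then show "generate G R \<subseteq> generate G ?C"
    using subgroups(2) by (intro generate_subgroup_incl) auto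
qed

end

locale reflection_subsystem = coxeter +
  fixes A :: "'a set"
  assumes canonical: "A \<subseteq> canonical_gens G S (generate G A)"
begin

lemma gens_subset_T: "A \<subseteq> T"
  using canonical canonical_gens_subset_T by blast

end

sublocale reflection_subsystem \<subseteq> A: involutions G A
  using gens_subset_T by (rule T_subset_involutions)

context reflection_subsystem
begin

abbreviation H :: "'a set" where "H \<equiv> generate G A"
abbreviation len\<^sub>A :: "'a \<Rightarrow> nat" where "len\<^sub>A \<equiv> cox_len G A"

declare A.generate_closed [simp]

lemma H_mult [simp]: "x \<in> H \<Longrightarrow> y \<in> H \<Longrightarrow> x \<otimes> y \<in> H"
  by (rule generate.eng)

lemma H_inv [simp]: "x \<in> H \<Longrightarrow> inv x \<in> H"
  using A.generate_subgroup by (rule subgroup.m_inv_closed)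

lemma gens_H [simp]: "a \<in> A \<Longrightarrow> a \<in> H"
  by (rule generate.incl)

lemma left_inversions_gen: "a \<in> A \<Longrightarrow> N a \<inter> H = {a}"
  using canonical by (auto simp: canonical_gens_def)

lemma crossing_parity_iff_left_inversion_gens:
  assumes "set ws \<subseteq> A" "t \<in> T" "t \<in> H"
  shows "crossing_parity G ws t \<longleftrightarrow> t \<in> N (wprod G ws)"
  using assms
proof (induction ws arbitrary: t)
  case (Cons a ws)
  then have a: "a \<in> A" "a \<in> T" "set ws \<subseteq> A" using gens_subset_T by auto
  have "a \<otimes> t \<otimes> a \<in> T" using T_conj [of t a] Cons.prems a by simp
  then have "crossing_parity G ws (a \<otimes> t \<otimes> a) \<longleftrightarrow> a \<otimes> t \<otimes> a \<in> N (wprod G ws)"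
    using Cons a by simp
  moreover have "t \<in> N a \<longleftrightarrow> t = a" using left_inversions_gen a(1) Cons.prems(3) by blast
  ultimately show ?case
    using left_inversions_mult [of a "wprod G ws" t] Cons.prems a by simp
qed simp

lemma left_inversion_iff_len_less:
  assumes "t \<in> T" "t \<in> H" "w \<in> H"
  shows "t \<in> N w \<longleftrightarrow> len\<^sub>A (t \<otimes> w) < len\<^sub>A w"
  using assms crossing_parity_iff_left_inversion_gens reflection_in_left_inversions
  by (intro A.crossing_parity_iff_len_less) simp_all

lemma not_left_inversion_iff_len_less:
  assumes "t \<in> T" "t \<in> H" "w \<in> H"
  shows "t \<notin> N w \<longleftrightarrow> len\<^sub>A w < len\<^sub>A (t \<otimes> w)"
  using assms left_inversion_iff_len_less [of t "t \<otimes> w"] left_inversions_mult_self [of t w]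
  by simp

lemma canonical_gens_generate: "canonical_gens G S H = A"
proof (intro subset_antisym subsetI)
  fix c assume c: "c \<in> canonical_gens G S H"
  then have "c \<in> H" "c \<noteq> \<one>"
    using canonical_gens_subset canonical_gens_subset_T one_notin_T by blast+
  then obtain a v where a: "a \<in> A" "v \<in> H" "c = a \<otimes> v" "len\<^sub>A v < len\<^sub>A c"
    by (rule A.ex_left_descent)
  then have "a \<in> N c"
    using gens_subset_T \<open>c \<in> H\<close> by (subst left_inversion_iff_len_less) auto
  then show "c \<in> A" using a(1) c by (auto simp: canonical_gens_def)
qed (use canonical in blast)

end

context coxeter
begin

lemma canonical_gens_generate_Int:
  assumes "subgroup H G" "A \<subseteq> canonical_gens G S H"
  shows "canonical_gens G S H \<inter> generate G A = A"
proof
  have "generate G A \<subseteq> H"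
    using assms canonical_gens_subset by (intro generate_subgroup_incl) blast+
  then have sub: "canonical_gens G S H \<inter> generate G A \<subseteq> canonical_gens G S (generate G A)"
    by (rule canonical_gens_Int_subset)
  then interpret reflection_subsystem G S A
    using assms(2) by unfold_locales (auto intro: generate.incl)
  show "canonical_gens G S H \<inter> generate G A \<subseteq> A" using sub canonical_gens_generate by simp
qed (use assms(2) in \<open>auto intro: generate.incl\<close>)

text \<open>An element of odd length in a group generated by two reflections is an alternating word of
  odd length, hence a palindrome.\<close>

lemma odd_len_two_reflections_involution:
  assumes "t \<in> T" "r \<in> T" "w \<in> generate G {t, r}" "odd (len w)"
  shows "inv w = w"
proof -
  interpret D: involutions G "{t, r}" using assms by (simp add: T_subset_involutions)
  obtain ws where ws: "D.reduced ws" "wprod G ws = w" using assms(3) by (rule D.ex_reduced)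
  then have words: "set ws \<subseteq> {t, r}" "distinct_adj ws"
    by (auto simp: D.reduced_def D.reduced_distinct_adj)
  have odd: "odd (length ws)" using even_len_T_word [of ws] words ws assms by auto
  then obtain x us where us: "ws = x # us" by (cases ws) auto
  then obtain y where "{t, r} = {y, x}" using words by auto
  then have "us = alt_word y x (length us)"
    using words us by (intro distinct_adj_eq_alt_word) auto
  then have "ws = alt_word x y (length ws)" using us by simp
  then have "rev ws = ws" using odd rev_alt_word_odd by metis
  then show ?thesis using D.inv_wprod [OF words(1)] ws by simp
qed

lemma canonical_gens_conj_neq:
  assumes "subgroup H G" "{a, b, c} \<subseteq> canonical_gens G S H" "a \<noteq> c" "b \<noteq> c"
  shows "a \<otimes> c \<otimes> a \<noteq> b"
proof
  have T: "a \<in> T" "b \<in> T" "c \<in> T" using assms(2) canonical_gens_subset_T by blast+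
  assume "a \<otimes> c \<otimes> a = b"
  then have "c = a \<otimes> b \<otimes> a" using T by (simp add: T.gen_conj_eq_iff)
  moreover have "a \<otimes> b \<otimes> a \<in> generate G {a, b}" by (intro generate.eng generate.incl) auto
  ultimately have "c \<in> {a, b}"
    using canonical_gens_generate_Int [OF assms(1), of "{a, b}"] assms(2) by blast
  then show False using assms(3,4) by auto
qed

text \<open>The odd element \<open>abc\<close> is an involution, so \<open>abc = cba\<close>. The word \<open>cba\<close> crosses the wall of
  \<open>c\<close>, and so must \<open>abc\<close>; this leaves only \<open>c = bacab\<close>.\<close>

lemma three_canonical_gens_commute:
  assumes "t \<in> T" "r \<in> T" and H: "H = generate G {t, r}"
    and abc: "{a, b, c} \<subseteq> canonical_gens G S H" and neq: "a \<noteq> b" "b \<noteq> c" "a \<noteq> c"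
  shows "a \<otimes> b = b \<otimes> a"
proof -
  have subgroup: "subgroup H G" unfolding H using assms(1,2) by (simp add: generate_T_subgroup)
  have gen: "generate G (canonical_gens G S H) = H"
    unfolding H using assms(1,2) by (intro generate_canonical_gens) auto
  interpret C: reflection_subsystem G S "canonical_gens G S H"
    by unfold_locales (simp add: gen)
  have mem: "a \<in> T" "b \<in> T" "c \<in> T" "a \<in> H" "b \<in> H" "c \<in> H"
    using abc canonical_gens_subset_T canonical_gens_subset by blast+
  have "a \<otimes> (b \<otimes> c) = inv (a \<otimes> (b \<otimes> c))"
  proof (rule odd_len_two_reflections_involution [symmetric, OF assms(1,2)])
    show "a \<otimes> (b \<otimes> c) \<in> generate G {t, r}" using mem by (auto simp: H intro: generate.eng)
    show "odd (len (a \<otimes> (b \<otimes> c)))" using even_len_T_word [of "[a, b, c]"] mem by simp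
  qed
  also have "\<dots> = c \<otimes> (b \<otimes> a)" using mem by (simp add: inv_mult_group m_assoc)
  finally have abc_eq_cba: "wprod G [a, b, c] = wprod G [c, b, a]" using mem by simp
  have "crossing_parity G [c, b, a] c"
    using canonical_gens_conj_neq [OF subgroup, of b a c] abc neq mem by simp
  moreover have "crossing_parity G ws c \<longleftrightarrow> c \<in> N (wprod G ws)" if "set ws \<subseteq> {a, b, c}" for ws
    using that abc mem gen by (intro C.crossing_parity_iff_left_inversion_gens) auto
  from this [of "[a, b, c]"] this [of "[c, b, a]"]
  have "crossing_parity G [a, b, c] c \<longleftrightarrow> crossing_parity G [c, b, a] c"
    unfolding abc_eq_cba by simp
  ultimately have "crossing_parity G [a, b, c] c" by blast
  then have "b \<otimes> (a \<otimes> c \<otimes> a) \<otimes> b = c"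
    using canonical_gens_conj_neq [OF subgroup, of a b c] abc neq by auto
  then have "a \<otimes> c \<otimes> a = b \<otimes> c \<otimes> b" using mem by (simp add: T.gen_conj_eq_iff)
  then have "a \<otimes> (a \<otimes> c \<otimes> a) \<otimes> b = a \<otimes> (b \<otimes> c \<otimes> b) \<otimes> b" by simp
  then have "c \<otimes> (a \<otimes> b) = a \<otimes> (b \<otimes> c)" using mem by (simp add: m_assoc)
  then have "c \<otimes> (a \<otimes> b) = c \<otimes> (b \<otimes> a)" using abc_eq_cba mem by simp
  then show ?thesis using mem by simp
qed

lemma reflections_canonical_if_commute:
  assumes "subgroup H G"
    and "\<And>a b. \<lbrakk>a \<in> canonical_gens G S H; b \<in> canonical_gens G S H\<rbrakk> \<Longrightarrow> a \<otimes> b = b \<otimes> a"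
  shows "T \<inter> H \<subseteq> canonical_gens G S H"
proof
  interpret C: involutions G "canonical_gens G S H"
    by (rule T_subset_involutions [OF canonical_gens_subset_T])
  fix t assume "t \<in> T \<inter> H"
  then obtain h a where t: "h \<in> generate G (canonical_gens G S H)" "a \<in> canonical_gens G S H"
    "t = h \<otimes> a \<otimes> inv h"
    using reflection_conj_canonical [OF assms(1)] by blast
  then have "h \<in> carrier G" "a \<in> carrier G" by (simp_all add: C.generate_closed)
  have "h \<otimes> a = a \<otimes> h"
    using \<open>a \<in> carrier G\<close> assms(2) [OF _ t(2)] t(1) by (rule C.generate_commute)
  then have "t = a"
    using t(3) \<open>h \<in> carrier G\<close> \<open>a \<in> carrier G\<close> by (simp add: m_assoc)
  then show "t \<in> canonical_gens G S H" using t(2) by simp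
qed

lemma canonical_gens_two_reflections:
  assumes "t \<in> T" "r \<in> T" "t \<noteq> r"
  obtains a b where "a \<noteq> b" "canonical_gens G S (generate G {t, r}) = {a, b}"
proof (cases "{t, r} \<subseteq> canonical_gens G S (generate G {t, r})")
  case True
  then interpret reflection_subsystem G S "{t, r}" by unfold_locales
  show ?thesis using that assms(3) canonical_gens_generate by blast
next
  case False
  let ?H = "generate G {t, r}" and ?C = "canonical_gens G S (generate G {t, r})"
  have H: "subgroup ?H G" "t \<in> ?H" "r \<in> ?H"
    using assms by (auto simp: generate_T_subgroup intro: generate.incl)
  then have "\<not> T \<inter> ?H \<subseteq> ?C" using False assms by blast
  then obtain a b where ab: "a \<in> ?C" "b \<in> ?C" "a \<otimes> b \<noteq> b \<otimes> a"
    using reflections_canonical_if_commute [OF H(1)] by blast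
  have "c \<in> {a, b}" if "c \<in> ?C" for c
    using three_canonical_gens_commute [OF assms(1,2) refl, of a b c] ab that by auto
  then show ?thesis using that [of a b] ab by blast
qed

end

section \<open>Dihedral reflection subgroups\<close>

context involutions
begin

definition left_ascent :: "'a \<Rightarrow> 'a \<Rightarrow> bool" where
  "left_ascent u v \<longleftrightarrow> u \<in> generate G A \<and> (\<exists>a\<in>A. v = a \<otimes> u) \<and> len\<^sub>A u < len\<^sub>A v"

lemma left_ascents_suffix:
  "reduced (us @ vs) \<Longrightarrow> left_ascent\<^sup>*\<^sup>* (wprod G vs) (wprod G (us @ vs))"
proof (induction us)
  case (Cons a us)
  then have tail: "reduced (us @ vs)" using reduced_append(2) [of "[a]" "us @ vs"] by simp
  then have "left_ascent (wprod G (us @ vs)) (wprod G (a # us @ vs))"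
    using Cons.prems by (auto simp: left_ascent_def reduced_def wprod_in_generate)
  with Cons.IH [OF tail] show ?case by simp
qed simp

text \<open>A reduced word of \<open>u\<close> stays reduced when \<open>e\<close> is appended, so it alternates and ends in \<open>f\<close>.\<close>

lemma reduced_alt_word_if_right_ascent:
  assumes A: "A = {e, f}" and u: "u \<in> generate G A" "len\<^sub>A u < len\<^sub>A (u \<otimes> e)"
  shows "reduced (rev (alt_word f e (len\<^sub>A u)))" "wprod G (rev (alt_word f e (len\<^sub>A u))) = u"
proof -
  have e: "e \<in> A" using A by simp
  obtain ws where ws: "reduced ws" "wprod G ws = u" using u(1) by (rule ex_reduced)
  then have words: "set ws \<subseteq> A" "length ws = len\<^sub>A u" by (auto simp: reduced_def)
  have "wprod G (ws @ [e]) = u \<otimes> e" using ws words(1) e by (simp add: wprod_append)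
  then have "reduced (ws @ [e])"
    using len_wprod_le [of "ws @ [e]"] u(2) words e by (simp add: reduced_def)
  then have "distinct_adj (rev (ws @ [e]))" by (intro reduced_distinct_adj reduced_rev)
  then have "rev ws = alt_word f e (len\<^sub>A u)"
    using distinct_adj_eq_alt_word [of "rev ws" f e] words A by (simp add: insert_commute)
  from arg_cong [OF this, of rev] have "rev (alt_word f e (len\<^sub>A u)) = ws" by simp
  then show "reduced (rev (alt_word f e (len\<^sub>A u)))" "wprod G (rev (alt_word f e (len\<^sub>A u))) = u"
    using ws by simp_all
qed

lemma left_ascents_if_right_ascents:
  assumes A: "A = {e, f}"
    and u: "u \<in> generate G A" "len\<^sub>A u < len\<^sub>A (u \<otimes> e)"
    and v: "v \<in> generate G A" "len\<^sub>A v < len\<^sub>A (v \<otimes> e)"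
    and le: "len\<^sub>A u \<le> len\<^sub>A v"
  shows "left_ascent\<^sup>*\<^sup>* u v"
proof -
  let ?u = "alt_word f e (len\<^sub>A u)" and ?v = "alt_word f e (len\<^sub>A v)"
  have "?v = ?u @ drop (len\<^sub>A u) ?v"
    using append_take_drop_id [of "len\<^sub>A u" ?v] le by (simp add: take_alt_word)
  then have split: "rev ?v = rev (drop (len\<^sub>A u) ?v) @ rev ?u" by (metis rev_append)
  have "left_ascent\<^sup>*\<^sup>* (wprod G (rev ?u)) (wprod G (rev ?v))"
    using reduced_alt_word_if_right_ascent(1) [OF A v] unfolding split
    by (rule left_ascents_suffix)
  then show ?thesis
    unfolding reduced_alt_word_if_right_ascent(2) [OF A u]
      reduced_alt_word_if_right_ascent(2) [OF A v] .
qed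

end

context coxeter
begin

lemma bruhat_lt_len:
  assumes "bruhat_lt G S u v" shows "len u < len v"
proof -
  have "(bruhat_step G S)\<^sup>*\<^sup>* u v" "u \<noteq> v"
    using assms by (auto simp: bruhat_lt_def bruhat_le_def)
  then have "(bruhat_step G S)\<^sup>+\<^sup>+ u v" by (auto dest: rtranclpD)
  then show ?thesis by (induction rule: tranclp_induct) (auto simp: bruhat_step_def)
qed

lemma bruhat_lt_reflection_iff:
  assumes "x \<in> carrier G" "t \<in> T"
  shows "bruhat_lt G S x (t \<otimes> x) \<longleftrightarrow> len x < len (t \<otimes> x)"
proof
  assume "len x < len (t \<otimes> x)"
  then have "bruhat_step G S x (t \<otimes> x)" using assms by (auto simp: bruhat_step_def)
  then show "bruhat_lt G S x (t \<otimes> x)"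
    using \<open>len x < len (t \<otimes> x)\<close> assms by (auto simp: bruhat_lt_def bruhat_le_def)
qed (rule bruhat_lt_len)

lemma LX_stepI:
  "t \<in> R \<Longrightarrow> t \<in> T \<Longrightarrow> x \<in> carrier G \<Longrightarrow> len x < len (t \<otimes> x) \<Longrightarrow> LX_step G S R x (t \<otimes> x)"
  by (auto simp: LX_step_def bruhat_lt_reflection_iff)

lemma LX_stepE:
  assumes "LX_step G S R x y"
  obtains t where "t \<in> R" "y = t \<otimes> x" "x \<in> carrier G" "y \<in> carrier G" "len x < len y"
  using assms bruhat_lt_len by (auto simp: LX_step_def bruhat_lt_def bruhat_le_def)

end

context reflection_subsystem
begin

lemma bruhat_arrow_on_left_ascent:
  assumes "A.left_ascent u v" shows "bruhat_arrow_on G S H u v"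
proof -
  obtain a where a: "a \<in> A" "a \<in> T" "v = a \<otimes> u" "u \<in> H" "len\<^sub>A u < len\<^sub>A v"
    using assms gens_subset_T by (auto simp: A.left_ascent_def)
  then have "len u < len (a \<otimes> u)"
    using not_left_inversion_iff_len_less [of a u] by (simp add: not_left_inversion_iff)
  moreover have "u \<otimes> inv (a \<otimes> u) = a" using a by (simp add: inv_mult_group flip: m_assoc)
  ultimately show ?thesis
    using a by (simp add: bruhat_arrow_on_def bruhat_arrow_def bruhat_lt_reflection_iff)
qed

lemma bruhat_arrow_on_inv:
  assumes "bruhat_arrow_on G S H u v" shows "bruhat_arrow_on G S H (inv u) (inv v)"
proof -
  have uv: "u \<in> H" "v \<in> H" "u \<otimes> inv v \<in> T" "len u < len v"
    using assms bruhat_lt_len by (auto simp: bruhat_arrow_on_def bruhat_arrow_def)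
  have r: "inv v \<otimes> u \<in> T"
    using T_conj_inv [OF uv(3), of u] uv(1,2) by (simp add: m_assoc)
  have "inv u \<otimes> inv (inv v) = inv v \<otimes> u"
    using T.gen_inv [OF r] uv(1,2) by (simp add: inv_mult_group)
  moreover have "bruhat_lt G S (inv u) (inv v)"
    using bruhat_lt_reflection_iff [of "inv u", OF _ r] uv by (simp add: m_assoc)
  moreover have "inv u \<in> H" "inv v \<in> H"
    using uv(1,2) by simp_all
  ultimately show ?thesis using r by (simp add: bruhat_arrow_on_def bruhat_arrow_def)
qed

lemma bruhat_path_from_letter:
  assumes "A.reduced (us @ a # vs)"
  shows "(bruhat_arrow_on G S H)\<^sup>*\<^sup>* a (wprod G (us @ a # vs))"
proof -
  let ?arrow = "bruhat_arrow_on G S H"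
  have arrows: "?arrow\<^sup>*\<^sup>* u v" if "A.left_ascent\<^sup>*\<^sup>* u v" for u v
    using that by (rule rtranclp_mono [THEN predicate2D, rotated])
      (auto intro: bruhat_arrow_on_left_ascent)
  have suffix: "A.reduced (a # vs)" using assms by (rule A.reduced_append)
  then have letters: "a \<in> A" "set vs \<subseteq> A" by (auto simp: A.reduced_def)
  have "?arrow\<^sup>*\<^sup>* (wprod G [a]) (wprod G (rev vs @ [a]))"
    using A.reduced_rev [OF suffix] by (intro arrows A.left_ascents_suffix) simp
  then have "?arrow\<^sup>*\<^sup>* (inv (wprod G [a])) (inv (wprod G (rev vs @ [a])))"
    by (induction rule: rtranclp_induct)
      (auto intro: bruhat_arrow_on_inv rtranclp.rtrancl_into_rtrancl)
  then have "?arrow\<^sup>*\<^sup>* a (wprod G (a # vs))"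
    using letters by (simp add: A.inv_wprod)
  also have "?arrow\<^sup>*\<^sup>* (wprod G (a # vs)) (wprod G (us @ a # vs))"
    using assms by (intro arrows A.left_ascents_suffix)
  finally show ?thesis .
qed

lemma gens_refl_sq:
  assumes "card A = 2" "a \<in> A" "t \<in> T" "t \<in> H" "t \<notin> A"
  shows "refl_sq G S a t"
proof -
  obtain b where b: "A = {a, b}" using assms(1,2) by (auto simp: card_2_iff)
  obtain ws where ws: "A.reduced ws" "wprod G ws = t" using assms(4) by (rule A.ex_reduced)
  have "a \<in> set ws"
  proof (rule ccontr)
    assume "a \<notin> set ws"
    moreover have "set ws \<subseteq> A" "distinct_adj ws"
      using ws(1) A.reduced_distinct_adj by (auto simp: A.reduced_def)
    ultimately have "set ws \<subseteq> {b}" "distinct_adj ws" using b by auto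
    then have "ws = [] \<or> ws = [b]"
      by (cases ws rule: remdups_adj.cases) auto
    then show False using ws b assms one_notin_T gens_subset_T by auto
  qed
  then obtain us vs where "ws = us @ a # vs" by (meson split_list)
  then have "(bruhat_arrow_on G S H)\<^sup>*\<^sup>* a t" using bruhat_path_from_letter ws by blast
  moreover have "finite A" using b by simp
  then have "dihedral_refl_subgroup G S H"
    using assms(1) gens_subset_T
    by (auto simp: dihedral_refl_subgroup_def reflection_subgroup_def canonical_gens_generate)
  ultimately have "refl_sq' G S a t"
    using assms gens_subset_T by (auto simp: refl_sq'_def)
  then show ?thesis unfolding refl_sq_def by blast
qed

lemma len_coset_less_iff:
  assumes "y \<in> carrier G" "N y \<inter> H = {}" "h \<in> H" "t \<in> T" "t \<in> H"
  shows "len (h \<otimes> y) < len (t \<otimes> (h \<otimes> y)) \<longleftrightarrow> len\<^sub>A h < len\<^sub>A (t \<otimes> h)"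
proof -
  have "t \<in> N (h \<otimes> y) \<longleftrightarrow> t \<in> N h"
    using left_inversions_coset [OF A.generate_subgroup assms(3,1,2)] assms(5) by blast
  then show ?thesis
    using not_left_inversion_iff [of t "h \<otimes> y"] not_left_inversion_iff_len_less [of t h] assms
    by simp
qed

lemma LX_steps_left_ascents:
  assumes "A \<subseteq> R" and y: "y \<in> carrier G" "N y \<inter> H = {}" and "A.left_ascent\<^sup>*\<^sup>* u v"
  shows "(LX_step G S R)\<^sup>*\<^sup>* (u \<otimes> y) (v \<otimes> y)"
  using assms(4)
proof (induction rule: rtranclp_induct)
  case (step v w)
  then obtain a where a: "a \<in> A" "w = a \<otimes> v" and v: "v \<in> H" "len\<^sub>A v < len\<^sub>A (a \<otimes> v)"
    by (auto simp: A.left_ascent_def)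
  then have "len (v \<otimes> y) < len (a \<otimes> (v \<otimes> y))"
    using len_coset_less_iff [OF y v(1)] gens_subset_T by auto
  then have "LX_step G S R (v \<otimes> y) (a \<otimes> (v \<otimes> y))"
    using a(1) v(1) y(1) gens_subset_T assms(1) by (intro LX_stepI) auto
  then show ?case using step.IH a v(1) y(1) by (simp add: m_assoc)
qed simp

lemma LX_steps_dihedral:
  assumes A: "A = {e, f}" "e \<noteq> f" and R: "order_ideal_T G S R" and t: "t \<in> R" "t \<in> H"
    and y: "y \<in> carrier G" "N y \<inter> H = {}" and h: "h \<in> H"
    and less: "len\<^sub>A h < len\<^sub>A (h \<otimes> e)" "len\<^sub>A (h \<otimes> e) < len\<^sub>A (t \<otimes> (h \<otimes> e))"
      "len\<^sub>A (t \<otimes> (h \<otimes> e)) < len\<^sub>A (t \<otimes> h)"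
  shows "(LX_step G S R)\<^sup>*\<^sup>* (h \<otimes> y) (t \<otimes> (h \<otimes> e) \<otimes> y)"
proof -
  have e: "e \<in> A" using A by simp
  have "t \<notin> A"
  proof
    assume "t \<in> A"
    then have "len\<^sub>A (t \<otimes> h) \<le> 1 + len\<^sub>A h"
      using A.len_mult_le [of t h] A.len_gen_le [of t] h by simp
    then show False using less by simp
  qed
  then have "A \<subseteq> R"
    using gens_refl_sq [of _ t] A t R by (auto simp: order_ideal_T_def)
  moreover have "A.left_ascent\<^sup>*\<^sup>* h (t \<otimes> (h \<otimes> e))"
    using less h t e by (intro A.left_ascents_if_right_ascents [OF A(1)]) (simp_all add: m_assoc)
  ultimately show ?thesis using y by (intro LX_steps_left_ascents)
qed

lemma LX_steps_dihedral_coset: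
  assumes A: "A = {e, f}" "e \<noteq> f" and R: "order_ideal_T G S R" and t: "t \<in> R" "t \<in> H"
    and y: "y \<in> carrier G" "N y \<inter> H = {}" and h: "h \<in> H"
    and less: "len (h \<otimes> y) < len (h \<otimes> e \<otimes> y)" "len (h \<otimes> e \<otimes> y) < len (t \<otimes> (h \<otimes> e \<otimes> y))"
      "len (t \<otimes> (h \<otimes> e \<otimes> y)) < len (t \<otimes> (h \<otimes> y))"
  shows "(LX_step G S R)\<^sup>*\<^sup>* (h \<otimes> y) (t \<otimes> (h \<otimes> e \<otimes> y))"
proof -
  have e: "e \<in> A" "e \<in> T" and tT: "t \<in> T"
    using A gens_subset_T R t(1) by (auto simp: order_ideal_T_def)
  define r where "r = h \<otimes> e \<otimes> inv h"
  have "r \<in> T" unfolding r_def using e(2) h by (intro T_conj) simp_all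
  moreover have "t \<otimes> r \<otimes> t \<in> T" using T_conj [OF \<open>r \<in> T\<close>, of t] tT by simp
  moreover have "r \<in> H" "r \<otimes> h = h \<otimes> e"
    using e(1) h by (simp_all add: r_def m_assoc)
  ultimately have r: "r \<in> T" "r \<in> H" "r \<otimes> h = h \<otimes> e" "t \<otimes> r \<otimes> t \<in> T" by simp_all
  have "len\<^sub>A h < len\<^sub>A (h \<otimes> e)"
    using len_coset_less_iff [OF y h r(1,2)] less(1) h y(1) r e(1) by (simp flip: m_assoc)
  moreover have "len\<^sub>A (h \<otimes> e) < len\<^sub>A (t \<otimes> (h \<otimes> e))"
    using len_coset_less_iff [OF y _ tT t(2), of "h \<otimes> e"] less(2) h e(1) by simp
  moreover have "len\<^sub>A (t \<otimes> (h \<otimes> e)) < len\<^sub>A (t \<otimes> h)"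
  proof -
    let ?v = "t \<otimes> (h \<otimes> e)"
    have v: "t \<otimes> r \<otimes> t \<otimes> ?v = t \<otimes> h"
      using tT r h by (simp add: m_assoc flip: r(3))
    moreover have "t \<otimes> r \<otimes> t \<otimes> (?v \<otimes> y) = t \<otimes> h \<otimes> y"
      using tT r(2) t(2) h e(1) y(1) unfolding v [symmetric] by (simp add: m_assoc)
    ultimately show ?thesis
      using len_coset_less_iff [OF y _ r(4), of ?v] less(3) t(2) r(2) h y(1) e(1)
      by (simp add: m_assoc)
  qed
  ultimately have "(LX_step G S R)\<^sup>*\<^sup>* (h \<otimes> y) (t \<otimes> (h \<otimes> e) \<otimes> y)"
    by (rule LX_steps_dihedral [OF A R t y h])
  then show ?thesis using tT h e y(1) by (simp add: m_assoc)
qed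

end

context coxeter
begin

lemma LX_steps_mult_S:
  assumes R: "order_ideal_T G S R" and t: "t \<in> R" and x: "x \<in> carrier G" and s: "s \<in> S"
    and less: "len x < len (x \<otimes> s)" "len (x \<otimes> s) < len (t \<otimes> (x \<otimes> s))"
      "len (t \<otimes> (x \<otimes> s)) < len (t \<otimes> x)"
  shows "(LX_step G S R)\<^sup>*\<^sup>* x (t \<otimes> (x \<otimes> s))"
proof -
  define r where "r = x \<otimes> s \<otimes> inv x"
  have T: "t \<in> T" "r \<in> T"
    using R t x s T_conj S_subset_T by (auto simp: order_ideal_T_def r_def)
  have "t \<noteq> r"
  proof
    assume "t = r"
    then have "t \<otimes> x = x \<otimes> s" using x s by (simp add: r_def m_assoc)
    then show False using less(2,3) by simp
  qed
  with T obtain a b where ab: "a \<noteq> b" "canonical_gens G S (generate G {t, r}) = {a, b}"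
    by (rule canonical_gens_two_reflections)
  have gen: "generate G {a, b} = generate G {t, r}"
    using generate_canonical_gens [of "{t, r}"] ab(2) T by simp
  interpret reflection_subsystem G S "{a, b}"
    by unfold_locales (simp add: ab(2) gen)
  have tr: "t \<in> H" "r \<in> H" unfolding gen by (auto intro: generate.incl)
  obtain h y where hy: "h \<in> H" "y \<in> carrier G" "x = h \<otimes> y" "N y \<inter> H = {}"
    using ex_coset_rep [OF A.generate_subgroup x] unfolding canonical_gens_generate by blast
  define e where "e = y \<otimes> s \<otimes> inv y"
  have xs: "x \<otimes> s = h \<otimes> e \<otimes> y" using hy s by (simp add: e_def m_assoc)
  have "e = inv h \<otimes> r \<otimes> h" using hy s by (simp add: e_def r_def inv_mult_group m_assoc)
  then have "e \<in> H" using hy(1) tr(2) by simp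
  then have "e \<in> {a, b}"
    using conj_S_canonical [OF A.generate_subgroup hy(2,4) s] canonical_gens_generate
    by (simp add: e_def)
  then obtain f where f: "{a, b} = {e, f}" "e \<noteq> f" using ab(1) by blast
  show ?thesis
    using less unfolding xs unfolding hy(3)
    by (rule LX_steps_dihedral_coset [OF f R t tr(1) hy(2,4,1)])
qed

end

section \<open>Projections to minimal coset representatives\<close>

context coxeter
begin

lemma le_LX_iff: "le_LX G S R u v \<longleftrightarrow> (LX_step G S R)\<^sup>*\<^sup>* u v"
proof -
  have "len u < len v" if "(LX_step G S R)\<^sup>+\<^sup>+ u v"
    using that by (induction rule: tranclp_induct) (auto elim!: LX_stepE)
  then show ?thesis by (auto simp: le_LX_def dest: rtranclpD)
qed

definition lower :: "'a \<Rightarrow> 'a \<Rightarrow> 'a" where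
  "lower s w = (if len (w \<otimes> s) < len w then w \<otimes> s else w)"

lemma reflection_ascent_mult_S:
  assumes "t \<in> T" "s \<in> S" "u \<in> carrier G" "len u < len (t \<otimes> u)" "len u < len (u \<otimes> s)"
  shows "t \<otimes> (u \<otimes> s) = u \<or> len (u \<otimes> s) < len (t \<otimes> (u \<otimes> s))"
proof (cases "t \<in> N (u \<otimes> s)")
  case True
  moreover have "t \<notin> N u" using assms by (simp add: not_left_inversion_iff)
  ultimately have "t = u \<otimes> s \<otimes> inv u"
    using left_inversions_mult_S [OF assms(3,2,5)] by simp
  then show ?thesis using assms(2,3) by (simp add: m_assoc)
next
  case False
  then show ?thesis using assms by (simp add: not_left_inversion_iff)
qed

lemma LX_steps_lower_step:
  assumes R: "order_ideal_T G S R" and s: "s \<in> S" and step: "LX_step G S R u v"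
  shows "(LX_step G S R)\<^sup>*\<^sup>* (lower s u) (lower s v)"
proof -
  obtain t where t: "t \<in> R" "t \<in> T" "v = t \<otimes> u"
    and u: "u \<in> carrier G" and less: "len u < len (t \<otimes> u)"
    using step R by (auto elim!: LX_stepE simp: order_ideal_T_def)
  have us: "u \<otimes> s \<in> carrier G" "u \<otimes> s \<otimes> s = u"
    and v: "v \<in> carrier G" "v \<otimes> s = t \<otimes> (u \<otimes> s)"
    using t u s by (simp_all add: m_assoc)
  note lens = len_mult_S [OF u s] len_mult_S [OF v(1) s]
  consider (neither) "\<not> len (u \<otimes> s) < len u" "\<not> len (v \<otimes> s) < len v"
    | (both) "len (u \<otimes> s) < len u" "len (v \<otimes> s) < len v"
    | (only_u) "len (u \<otimes> s) < len u" "\<not> len (v \<otimes> s) < len v"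
    | (only_v) "\<not> len (u \<otimes> s) < len u" "len (v \<otimes> s) < len v"
    by blast
  then show ?thesis
  proof cases
    case neither
    then show ?thesis using step by (simp add: lower_def)
  next
    case both
    then have "LX_step G S R (u \<otimes> s) (t \<otimes> (u \<otimes> s))"
      using lens less t v us by (intro LX_stepI) auto
    then show ?thesis using both v(2) by (simp add: lower_def)
  next
    case only_u
    then have "(LX_step G S R)\<^sup>*\<^sup>* (u \<otimes> s) (t \<otimes> (u \<otimes> s \<otimes> s))"
      using lens less t(3) v(2) us(2) by (intro LX_steps_mult_S [OF R t(1) us(1) s]) simp_all
    then show ?thesis using only_u us(2) t(3) by (simp add: lower_def)
  next
    case only_v
    then have "len u < len (u \<otimes> s)" using lens(1) by simp
    with t(2) s u less consider "t \<otimes> (u \<otimes> s) = u" | "len (u \<otimes> s) < len (t \<otimes> (u \<otimes> s))"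
      using reflection_ascent_mult_S by blast
    then have "(LX_step G S R)\<^sup>*\<^sup>* u (t \<otimes> (u \<otimes> s))"
      using only_v(2) \<open>len u < len (u \<otimes> s)\<close> t(3) v(2)
      by cases (auto intro: LX_steps_mult_S [OF R t(1) u s])
    then show ?thesis using only_v v(2) by (simp add: lower_def)
  qed
qed

lemma LX_steps_lower:
  assumes "order_ideal_T G S R" "s \<in> S" "(LX_step G S R)\<^sup>*\<^sup>* u v"
  shows "(LX_step G S R)\<^sup>*\<^sup>* (lower s u) (lower s v)"
  using assms(3)
  by (induction rule: rtranclp_induct)
    (auto intro: rtranclp_trans LX_steps_lower_step [OF assms(1,2)])

end

locale parabolic = coxeter +
  fixes J :: "'a set"
  assumes J_subset: "J \<subseteq> S"

sublocale parabolic \<subseteq> J: reflection_subsystem G S J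
proof
  show "J \<subseteq> canonical_gens G S (generate G J)"
    using J_subset S_subset_T
    by (auto simp: canonical_gens_def left_inversions_S intro: generate.incl)
qed

context parabolic
begin

lemma J_S [simp]: "s \<in> J \<Longrightarrow> s \<in> S"
  using J_subset by blast

lemma inv_mem_min_coset_reps_iff:
  assumes "x \<in> carrier G"
  shows "inv x \<in> min_coset_reps G S J \<longleftrightarrow> N x \<inter> J.H = {}"
proof -
  have "len (inv x) < len (inv x \<otimes> s) \<longleftrightarrow> s \<notin> N x" if s: "s \<in> J" for s
  proof -
    have "s \<in> T" using s J.gens_subset_T by blast
    then show ?thesis
      using s assms S.len_inv [of "s \<otimes> x"] by (simp add: not_left_inversion_iff inv_mult_group)
  qed
  then have "inv x \<in> min_coset_reps G S J \<longleftrightarrow> N x \<inter> J = {}"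
    using assms by (auto simp: min_coset_reps_def)
  also have "\<dots> \<longleftrightarrow> N x \<inter> J.H = {}"
    using ex_canonical_left_inversion [OF J.A.generate_subgroup assms] J.canonical_gens_generate
    by auto
  finally show ?thesis .
qed

lemma len_generate_J_mult:
  assumes y: "y \<in> carrier G" "N y \<inter> J.H = {}" and "h \<in> J.H"
  shows "len (h \<otimes> y) = len h + len y"
  using assms(3)
proof (induction "cox_len G J h" arbitrary: h rule: less_induct)
  case less
  show ?case
  proof (cases "h = \<one>")
    case False
    with less.prems obtain s v where s: "s \<in> J" "v \<in> J.H" "h = s \<otimes> v" "J.len\<^sub>A v < J.len\<^sub>A h"
      by (rule J.A.ex_left_descent)
    then have "s \<in> T" "s \<in> J.H" using S_subset_T by auto
    then have "len v < len (s \<otimes> v)" "len (v \<otimes> y) < len (s \<otimes> (v \<otimes> y))"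
      using s J.len_coset_less_iff [OF y s(2), of s] J.not_left_inversion_iff_len_less [of s v]
      by (simp_all add: not_left_inversion_iff)
    moreover have "len (v \<otimes> y) = len v + len y" using less.hyps s(2,4) by blast
    ultimately show ?thesis
      using len_S_mult [of s v] len_S_mult [of s "v \<otimes> y"] s y(1) by (simp add: m_assoc)
  qed (use y in simp)
qed

lemma len_min_coset_rep_mult:
  assumes "x \<in> min_coset_reps G S J" "y \<in> J.H"
  shows "len (x \<otimes> y) = len x + len y"
proof -
  have x: "x \<in> carrier G" using assms(1) by (simp add: min_coset_reps_def)
  then have "len (inv y \<otimes> inv x) = len (inv y) + len (inv x)"
    using assms inv_mem_min_coset_reps_iff [of "inv x"] by (intro len_generate_J_mult) simp_all
  then show ?thesis using x assms(2) S.len_inv [of "x \<otimes> y"] by (simp add: inv_mult_group)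
qed

lemma ex_min_coset_rep:
  assumes "w \<in> carrier G"
  obtains x y where "x \<in> min_coset_reps G S J" "y \<in> J.H" "w = x \<otimes> y"
proof -
  obtain h z where hz: "h \<in> J.H" "z \<in> carrier G" "inv w = h \<otimes> z" "N z \<inter> J.H = {}"
    using ex_coset_rep [OF J.A.generate_subgroup, of "inv w"] assms
    unfolding J.canonical_gens_generate by blast
  then have "w = inv z \<otimes> inv h"
    using assms inv_inv [of w] by (simp add: inv_mult_group del: inv_inv)
  then show ?thesis
    using that [of "inv z" "inv h"] hz inv_mem_min_coset_reps_iff by simp
qed

lemma min_coset_rep_unique:
  assumes x: "x \<in> min_coset_reps G S J" "x \<otimes> y \<in> min_coset_reps G S J" and y: "y \<in> J.H"
  shows "y = \<one>"
proof -
  have "x \<in> carrier G" using x by (simp add: min_coset_reps_def)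
  have "inv y \<in> J.H" using y by simp
  then have "len (x \<otimes> y \<otimes> inv y) = len (x \<otimes> y) + len (inv y)"
    by (rule len_min_coset_rep_mult [OF x(2)])
  then have "len y = 0"
    using len_min_coset_rep_mult [OF x(1) y] \<open>x \<in> carrier G\<close> y by (simp add: m_assoc)
  then show ?thesis using S.len_eq_0_iff y by simp
qed

lemma proj_J_mult:
  assumes x: "x \<in> min_coset_reps G S J" and y: "y \<in> J.H"
  shows "proj_J G S J (x \<otimes> y) = x"
  unfolding proj_J_def
proof (rule the_equality)
  fix x' assume x': "x' \<in> min_coset_reps G S J \<and>
    (\<exists>z\<in>J.H. x \<otimes> y = x' \<otimes> z \<and> len (x \<otimes> y) = len x' + len z)"
  then obtain z where z: "z \<in> J.H" "x \<otimes> y = x' \<otimes> z" by blast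
  have closed: "x \<in> carrier G" "x' \<in> carrier G" using x x' by (simp_all add: min_coset_reps_def)
  have "x' = x' \<otimes> z \<otimes> inv z" using closed z(1) by (simp add: m_assoc)
  also have "\<dots> = x \<otimes> (y \<otimes> inv z)"
    unfolding z(2) [symmetric] using closed y z(1) by (simp add: m_assoc)
  finally have x'_eq: "x' = x \<otimes> (y \<otimes> inv z)" .
  have "y \<otimes> inv z \<in> J.H" using y z(1) by simp
  then have "y \<otimes> inv z = \<one>" using min_coset_rep_unique [OF x] x' x'_eq by simp
  then show "x' = x" using x'_eq closed by simp
qed (use x y len_min_coset_rep_mult in blast)

lemma proj_J_lower:
  assumes "w \<in> carrier G" "s \<in> J"
  shows "proj_J G S J (lower s w) = proj_J G S J w"
proof -
  obtain x y where xy: "x \<in> min_coset_reps G S J" "y \<in> J.H" "w = x \<otimes> y"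
    using assms(1) by (rule ex_min_coset_rep)
  then have "w \<otimes> s = x \<otimes> (y \<otimes> s)" using assms(2) by (simp add: min_coset_reps_def m_assoc)
  moreover have "y \<otimes> s \<in> J.H" using xy assms(2) by simp
  ultimately show ?thesis using xy by (simp add: lower_def proj_J_mult)
qed

lemma proj_J_eq_self: "x \<in> min_coset_reps G S J \<Longrightarrow> proj_J G S J x = x"
  using proj_J_mult [of x \<one>] by (simp add: generate.one min_coset_reps_def)

lemma LX_steps_proj_J:
  assumes R: "order_ideal_T G S R" and "u \<in> carrier G" "v \<in> carrier G" "(LX_step G S R)\<^sup>*\<^sup>* u v"
  shows "(LX_step G S R)\<^sup>*\<^sup>* (proj_J G S J u) (proj_J G S J v)"
  using assms(2-4)
proof (induction "len u + len v" arbitrary: u v rule: less_induct)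
  case less
  show ?case
  proof (cases "u \<in> min_coset_reps G S J \<and> v \<in> min_coset_reps G S J")
    case True
    then show ?thesis using less.prems(3) by (simp add: proj_J_eq_self)
  next
    case False
    then obtain s where s: "s \<in> J" "\<not> len u < len (u \<otimes> s) \<or> \<not> len v < len (v \<otimes> s)"
      using less.prems by (auto simp: min_coset_reps_def)
    then have "len (lower s u) + len (lower s v) < len u + len v"
      using len_mult_S [of u s] len_mult_S [of v s] less.prems(1,2) by (auto simp: lower_def)
    moreover have "lower s u \<in> carrier G" "lower s v \<in> carrier G"
      using less.prems(1,2) s(1) by (simp_all add: lower_def)
    moreover have "(LX_step G S R)\<^sup>*\<^sup>* (lower s u) (lower s v)"
      using LX_steps_lower [OF R _ less.prems(3)] s(1) by simp
    ultimately show ?thesis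
      using less.hyps less.prems(1,2) s(1) by (metis proj_J_lower)
  qed
qed

end

context coxeter
begin

lemma refl_sq_len:
  assumes "refl_sq G S t t'" shows "t \<in> T \<and> len t \<le> len t'"
proof -
  have path: "len u \<le> len v" if "(bruhat_arrow_on G S H)\<^sup>*\<^sup>* u v" for H u v
    using that
    by (induction rule: rtranclp_induct)
      (auto simp: bruhat_arrow_on_def bruhat_arrow_def dest!: bruhat_lt_len)
  show ?thesis
    using assms unfolding refl_sq_def
    by (induction rule: tranclp_induct) (auto simp: refl_sq'_def dest!: path)
qed

lemma order_ideal_refl_T_k: "order_ideal_T G S (refl_T_k G S k)"
  unfolding order_ideal_T_def refl_T_k_def by (auto dest!: refl_sq_len)

end

theorem theorem3p8:
  fixes G :: "('a, 'b) monoid_scheme" and S J :: "'a set"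
  assumes "coxeter_system G S" and "J \<subseteq> S"
  shows "(\<forall>R. order_ideal_T G S R \<longrightarrow>
            (\<forall>u \<in> carrier G. \<forall>v \<in> carrier G. le_LX G S R u v \<longrightarrow>
               le_LX G S R (proj_J G S J u) (proj_J G S J v)))
       \<and> (\<forall>k::nat. \<forall>u \<in> carrier G. \<forall>v \<in> carrier G. le_Lk G S k u v \<longrightarrow>
               le_Lk G S k (proj_J G S J u) (proj_J G S J v))"
proof -
  have "group G" using assms(1) by (simp add: coxeter_system_def)
  then interpret parabolic G S J
    using assms
    by (intro parabolic.intro coxeter.intro coxeter_axioms.intro parabolic_axioms.intro)
  have mono: "le_LX G S R (proj_J G S J u) (proj_J G S J v)"
    if "order_ideal_T G S R" "u \<in> carrier G" "v \<in> carrier G" "le_LX G S R u v" for R u v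
    using that LX_steps_proj_J by (simp add: le_LX_iff)
  then show ?thesis
    using order_ideal_refl_T_k unfolding le_Lk_def by blast
qed

end
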